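(* Let $\mathbb{F}$ be a finite field of odd order $q$, let $\theta$ be a non-trivial additive character of $\mathbb{F}$, let $\epsilon=1$ if $q\equiv1\pmod 4$ and $\epsilon=-1$ if $q\equiv3\pmod4$, and let $\gamma=\sum_{a\in\mathbb{F}\setminus\{0\}}\operatorname{sgn}(a)\overline{\theta(a)}$, where $\operatorname{sgn}(a)=1$ if $a$ is a square and $-1$ otherwise. For $n\ge1$ and odd $s,r$ with $1\le s,r\le n$, $$\Psi^{(4)}_n(s,r)=(-1)^{x}\epsilon^{x+y}q^{n+x^2-y-1}\,\gamma\,(q^{2N+(-1)^n};q^{-2})_x\begin{bmatrix} N \\ x \end{bmatrix}_{q^2}K^{\mathrm{Aff}}_y(x;q^{-2N-(-1)^n},N;q^2),$$ where $N=\lfloor\frac{n-1}2\rfloor$, $y=\frac{s-1}2$, $x=\frac{r-1}2$. Here $\Psi^{(4)}_n$ is the block defined in the context of the matrix of the Fourier transformation of $\operatorname{GL}_n(\mathbb{F})$-invariant functions on symmetric matrices.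
   Context: $\operatorname{Sym}_n$ is the space of $n\times n$ symmetric matrices over $\mathbb{F}$, with $\operatorname{GL}_n(\mathbb{F})$ acting by $a\mapsto ga\,{}^tg$. Fix a non-square $\delta\in\mathbb{F}$. Every non-zero $a\in\operatorname{Sym}_n$ is in the orbit of exactly one of the matrices $\operatorname{diag}(1,\dots,1,0,\dots,0)$ or $\operatorname{diag}(1,\dots,1,\delta,0,\dots,0)$; put $\operatorname{sgn}(a)=1$ in the first case, $-1$ in the second, and $\operatorname{sgn}(0)=1$. Identify $\operatorname{Sym}_n$ with its character group via $a\mapsto\theta_a$, $\theta_a(b)=\theta(\operatorname{trace}({}^tab))$. On $\operatorname{Sym}_n$, let $\chi_r$ ($0\le r\le n$) be the characteristic function of the matrices of rank $r$, and ${}^{\operatorname{sgn}}\chi_r(a)=\operatorname{sgn}(a)\chi_r(a)$ ($1\le r\le n$). These form a basis of the $\operatorname{GL}_n(\mathbb{F})$-invariant functions on $\operatorname{Sym}_n$. Use the same notation on the character group: $\chi_s(\theta_a)=\chi_s(a)$, ${}^{\operatorname{sgn}}\chi_s(\theta_a)={}^{\operatorname{sgn}}\chi_s(a)$. The Fourier transformation is $\mathcal{F}\varphi(\xi)=\sum_{a\in\operatorname{Sym}_n}\overline{\xi(a)}\varphi(a)$. The numbers $\Psi^{(i)}_n(s,r)$ are defined by $$\mathcal{F}(\chi_r)=\sum_{s=0}^n\Psi^{(1)}_n(s,r)\chi_s+\sum_{s=1}^n\Psi^{(3)}_n(s,r)\,{}^{\operatorname{sgn}}\chi_s\quad(0\le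 r\le n),$$ $$\mathcal{F}({}^{\operatorname{sgn}}\chi_r)=\sum_{s=0}^n\Psi^{(2)}_n(s,r)\chi_s+\sum_{s=1}^n\Psi^{(4)}_n(s,r)\,{}^{\operatorname{sgn}}\chi_s\quad(1\le r\le n).$$ Notation: $(a;q)_k=(1-a)(1-aq)\cdots(1-aq^{k-1})$, $(a;q)_0=1$; $\begin{bmatrix} N \\ x \end{bmatrix}_q=\dfrac{(q^N;q^{-1})_x}{(q;q)_x}$. Affine $q$-Krawtchouk polynomial: for integers $0\le y\le N$, $$K^{\mathrm{Aff}}_y(x;a,N;q)=\sum_{k=0}^{y}\frac{(q^{-y};q)_k\,(q^{-x};q)_k}{(q^{-N};q)_k\,(a;q)_k\,(q;q)_k}\,q^k;$$ in the claim these are used with $q$ replaced by $q^2$. *)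

theory Defs
  imports
    Complex_Main
    "HOL-Library.Cardinality"
    "HOL-Computational_Algebra.Primes"
    "HOL-Computational_Algebra.Nth_Powers"
    "Jordan_Normal_Form.DL_Rank"
begin

definition additive_character :: "('a :: field \<Rightarrow> complex) \<Rightarrow> bool" where
  "additive_character \<theta> \<longleftrightarrow> \<theta> 0 = 1 \<and> (\<forall>a b. \<theta> (a + b) = \<theta> a * \<theta> b)"

definition Sym :: "nat \<Rightarrow> 'a :: field mat set" where
  "Sym n = {a \<in> carrier_mat n n. transpose_mat a = a}"

definition mat_trace :: "'a :: comm_monoid_add mat \<Rightarrow> 'a" where
  "mat_trace a = (\<Sum>i<dim_row a. a $$ (i, i))"

definition in_orbit :: "nat \<Rightarrow> 'a :: field mat \<Rightarrow> 'a mat \<Rightarrow> bool" where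
  "in_orbit n a d \<longleftrightarrow>
     (\<exists>g \<in> carrier_mat n n. invertible_mat g \<and> a = g * d * transpose_mat g)"

text \<open>The diagonal matrices with diagonal (1, ..., 1, 0, ..., 0) and
  (1, ..., 1, d, 0, ..., 0), each with \<open>r\<close> non-zero entries.\<close>

definition diag_one :: "nat \<Rightarrow> nat \<Rightarrow> 'a :: field mat" where
  "diag_one n r = mat_diag n (\<lambda>i. if i < r then 1 else 0)"

definition diag_delta :: "'a :: field \<Rightarrow> nat \<Rightarrow> nat \<Rightarrow> 'a mat" where
  "diag_delta d n r =
     mat_diag n (\<lambda>i. if i + 1 < r then 1 else if i + 1 = r then d else 0)"

text \<open>Over a finite field of odd order, with \<open>d\<close> a non-square, exactly one of the first two cases
  below holds for every symmetric matrix; the value 0 is never taken on \<open>Sym n\<close>. The case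
  \<open>r = 0\<close> of the first line gives the zero matrix the sign 1.\<close>

definition sgn_sym :: "'a :: field \<Rightarrow> nat \<Rightarrow> 'a mat \<Rightarrow> complex" where
  "sgn_sym d n a =
     (if \<exists>r\<in>{0..n}. in_orbit n a (diag_one n r) then 1
      else if \<exists>r\<in>{1..n}. in_orbit n a (diag_delta d n r) then -1
      else 0)"

definition chi :: "nat \<Rightarrow> nat \<Rightarrow> 'a :: field mat \<Rightarrow> complex" where
  "chi n r a = (if vec_space.rank n a = r then 1 else 0)"

definition sgn_chi :: "'a :: field \<Rightarrow> nat \<Rightarrow> nat \<Rightarrow> 'a mat \<Rightarrow> complex" where
  "sgn_chi d n r a = sgn_sym d n a * chi n r a"

definition sym_char :: "('a :: field \<Rightarrow> complex) \<Rightarrow> 'a mat \<Rightarrow> 'a mat \<Rightarrow> complex" where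
  "sym_char \<theta> a b = \<theta> (mat_trace (transpose_mat a * b))"

text \<open>The Fourier transform of a function on \<open>Sym n\<close> is a function of the character \<open>\<xi>\<close>.\<close>

definition fourier ::
    "nat \<Rightarrow> ('a :: field mat \<Rightarrow> complex) \<Rightarrow> ('a mat \<Rightarrow> complex) \<Rightarrow> complex" where
  "fourier n \<phi> \<xi> = (\<Sum>a\<in>Sym n. cnj (\<xi> a) * \<phi> a)"

text \<open>The function \<open>\<Phi>\<close> on the character group of \<open>Sym n\<close> is the linear combination of the basis
  functions with coefficients \<open>c s\<close> (of chi, \<open>0 \<le> s \<le> n\<close>) and \<open>d s\<close> (of sgn-chi,
  \<open>1 \<le> s \<le> n\<close>). Every character is \<open>sym_char \<theta> a\<close> for a unique \<open>a\<close> in \<open>Sym n\<close>, and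
  a basis function takes at this character the value that it takes at \<open>a\<close>.\<close>

definition has_expansion ::
    "('a :: field \<Rightarrow> complex) \<Rightarrow> 'a \<Rightarrow> nat \<Rightarrow> (('a mat \<Rightarrow> complex) \<Rightarrow> complex)
       \<Rightarrow> (nat \<Rightarrow> complex) \<Rightarrow> (nat \<Rightarrow> complex) \<Rightarrow> bool" where
  "has_expansion \<theta> \<delta> n \<Phi> c d \<longleftrightarrow>
     (\<forall>a\<in>Sym n. \<Phi> (sym_char \<theta> a) =
        (\<Sum>s=0..n. c s * chi n s a) + (\<Sum>s=1..n. d s * sgn_chi \<delta> n s a))"

text \<open>The coefficient of \<open>sgn_chi \<delta> n s\<close> in the expansion of the transform of
  \<open>sgn_chi \<delta> n r\<close>, for \<open>1 \<le> s \<le> n\<close> and \<open>1 \<le> r \<le> n\<close>.\<close>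

definition Psi4 :: "('a :: field \<Rightarrow> complex) \<Rightarrow> 'a \<Rightarrow> nat \<Rightarrow> nat \<Rightarrow> nat \<Rightarrow> complex" where
  "Psi4 \<theta> \<delta> n s r =
     (THE z. \<exists>c d. has_expansion \<theta> \<delta> n (fourier n (sgn_chi \<delta> n r)) c d \<and> z = d s)"

text \<open>\<open>qpoch a q k\<close> is \<open>(a; q)_k\<close>.\<close>

definition qpoch :: "'b :: field \<Rightarrow> 'b \<Rightarrow> nat \<Rightarrow> 'b" where
  "qpoch a q k = (\<Prod>i<k. 1 - a * q ^ i)"

definition qbinom :: "nat \<Rightarrow> nat \<Rightarrow> 'b :: field \<Rightarrow> 'b" where
  "qbinom N x q = qpoch (q ^ N) (inverse q) x / qpoch q q x"

definition affine_q_Krawtchouk :: "nat \<Rightarrow> nat \<Rightarrow> 'b :: field \<Rightarrow> nat \<Rightarrow> 'b \<Rightarrow> 'b" where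
  "affine_q_Krawtchouk y x a N q =
     (\<Sum>k=0..y. qpoch (q powi (- int y)) q k * qpoch (q powi (- int x)) q k
        / (qpoch (q powi (- int N)) q k * qpoch a q k * qpoch q q k) * q ^ k)"

end

(*
Congruence invariants of a symmetric matrix a are read off the Gauss sum
W(a) = (sum over u of psi(u . a u)) = q^(n - rank a) * gamma^(rank a) * sgn(a), psi = cnj o theta.

Let G(n,r,b) be the transform of the signed characteristic function of rank r at b. For b' on n-1
variables, G(n,r,1+b') - G(n,r,0+b') only sees matrices with a nonzero corner entry, and the Schur
complement turns it into a Gauss sum times G(n-1,r-1,b'). Scaling by a nonsquare gives
G(n,r,b) = 0 for odd r and even rank b. Hence at b of odd rank and odd r, G is a multiple of
H(m,x,y) = G(m,2x,diag(1^(2y),0)), m = n-1, and two peeling steps give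
  H(m,x,y) = H(m,x,y-1) - epsilon * q^(2m-2y) * H(m-2,x-1,y-1).

The boundary values H(m,x,0) are differences of orbit sizes. They are found without counting orbits:
summing G over all b = u u^t produces W(a), which links the signed and the unsigned number of
matrices of rank r. The q-Krawtchouk expression satisfies the same recurrence and boundary values.
*)

theory Submission
  imports Defs "Jordan_Normal_Form.Schur_Decomposition"
begin

section \<open>Quadratic characters and Gauss sums\<close>

text \<open>The sign is defined by the existence of a congruence. Since the Gauss sum is nonzero,
  the formula for W(a) turns each question about signs into the evaluation of a sum; it also
  separates the two normal forms of equal rank. Why two peeling steps close up: every value with odd
  r at a point of even rank is zero. So a peel from even to odd rank keeps only the Gauss term when
  r is odd, and only the old value when r is even. Why the boundary values close up: let sigma be
  the exponent of the sign in the sum. Averaging over all u u^t raises sigma by one, sigma and sigma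
  + 2 agree, and the signed count at odd rank is zero. The relation with sigma = 1 therefore gives
  the ratio of the unsigned to the signed count at even rank, and sigma = 0, used at ranks 2x+1 and
  2x+2, gives the passage from rank 2x to rank 2x+2. On the polynomial side the recurrence is a
  q-difference equation in y: in each term y occurs only in (q^(-2y); q^2)_k, whose difference in y
  is a multiple of the symbol of length k-1.\<close>

lemma odd_finite_field_two_nonzero:
  assumes "odd CARD('a :: finite_field)"
  shows "(2 :: 'a) \<noteq> 0"
proof
  assume two: "(2 :: 'a) = 0"
  \<comment> \<open>Translation by 1 permutes the field, so \<open>CARD('a)\<close> copies of 1 add
    up to 0; if 2 = 0 and the cardinality is odd, they also add up to 1.\<close>
  have "(\<Sum>y\<in>UNIV. y) = (\<Sum>y\<in>UNIV. 1 + y :: 'a)"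
    by (rule sum.reindex_bij_witness[of _ "\<lambda>y. 1 + y" "\<lambda>y. y - 1"]) auto
  then have card0: "(of_nat CARD('a) :: 'a) = 0"
    by (simp add: sum.distrib)
  obtain k where "CARD('a) = 2 * k + 1" using assms by (elim oddE)
  then have "(of_nat CARD('a) :: 'a) = 2 * of_nat k + 1"
    by (metis of_nat_1 of_nat_add of_nat_mult of_nat_numeral)
  with card0 two show False by simp
qed

text \<open>The value 0 at 0 makes the character multiplicative on the whole field and lets its sums
  run over \<open>UNIV\<close>.\<close>

definition quadratic_char :: "'a :: field \<Rightarrow> complex" where
  "quadratic_char a = (if a = 0 then 0 else if is_square a then 1 else -1)"

lemma quadratic_char_0 [simp]: "quadratic_char 0 = 0"
  by (simp add: quadratic_char_def)

lemma quadratic_char_1 [simp]: "quadratic_char 1 = 1"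
  by (simp add: quadratic_char_def)

lemma card_square_roots:
  assumes "odd CARD('a :: finite_field)"
  shows "of_nat (card {x :: 'a. x\<^sup>2 = y}) = 1 + quadratic_char y"
proof -
  note two = odd_finite_field_two_nonzero[OF assms]
  consider "y = 0" | x where "y \<noteq> 0" "y = x\<^sup>2" | "y \<noteq> 0" "\<not> is_square y"
    by (metis is_nth_power_def)
  then show ?thesis
  proof cases
    case 1
    then have "{x. x\<^sup>2 = y} = {0}" by auto
    with 1 show ?thesis by simp
  next
    case 2
    then have "x \<noteq> -x" using two by (simp add: eq_neg_iff_add_eq_0 flip: mult_2)
    moreover have "{z. z\<^sup>2 = y} = {x, -x}" using 2 by (auto simp: power2_eq_iff)
    ultimately show ?thesis using 2 by (simp add: quadratic_char_def)
  next
    case 3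
    then have "{z. z\<^sup>2 = y} = {}" by (auto simp: is_nth_power_def)
    with 3 show ?thesis by (simp add: quadratic_char_def)
  qed
qed

text \<open>Squaring hits \<open>y\<close> exactly \<open>1 + quadratic_char y\<close> times. This
  is what converts sums over squares into character sums.\<close>

lemma sum_over_squares:
  fixes f :: "'a :: finite_field \<Rightarrow> complex"
  assumes "odd CARD('a)"
  shows "(\<Sum>x\<in>UNIV. f (x\<^sup>2)) = (\<Sum>y\<in>UNIV. (1 + quadratic_char y) * f y)"
proof -
  have "(\<Sum>x\<in>UNIV. f (x\<^sup>2)) = (\<Sum>y\<in>UNIV. \<Sum>x | x\<^sup>2 = y. f (x\<^sup>2))"
    using sum.group[of UNIV UNIV "\<lambda>x. x\<^sup>2" "\<lambda>x. f (x\<^sup>2)"] by simp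
  also have "\<dots> = (\<Sum>y\<in>UNIV. of_nat (card {x :: 'a. x\<^sup>2 = y}) * f y)"
    by (intro sum.cong) simp_all
  finally show ?thesis by (simp add: card_square_roots[OF assms])
qed

lemma sum_quadratic_char:
  assumes "odd CARD('a :: finite_field)"
  shows "(\<Sum>y\<in>UNIV. quadratic_char (y :: 'a)) = 0"
  using sum_over_squares[OF assms, of "\<lambda>_. 1"] by (simp add: sum.distrib)

lemma card_nonzero_squares:
  assumes "odd CARD('a :: finite_field)"
  shows "2 * card {y :: 'a. y \<noteq> 0 \<and> is_square y} + 1 = CARD('a)"
proof -
  let ?S = "{y :: 'a. y \<noteq> 0 \<and> is_square y}" and ?N = "{y :: 'a. \<not> is_square y}"
  have "(\<Sum>y\<in>UNIV. quadratic_char (y :: 'a)) =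
      (\<Sum>y\<in>UNIV. (if y \<in> ?S then 1 else 0) - (if y \<in> ?N then 1 else 0))"
    by (intro sum.cong) (auto simp: quadratic_char_def)
  also have "\<dots> = of_nat (card ?S) - of_nat (card ?N)"
    by (simp add: sum_subtractf sum.If_cases)
  finally have "card ?S = card ?N"
    by (simp add: sum_quadratic_char[OF assms])
  moreover have "CARD('a) = card ({0} \<union> ?S \<union> ?N)"
    by (rule arg_cong[of _ _ card]) auto
  moreover have "card ({0} \<union> ?S \<union> ?N) = 1 + card ?S + card ?N"
    by (subst card_Un_disjoint, simp_all, fastforce)
  ultimately show ?thesis by simp
qed

text \<open>The nonzero squares already exhaust the roots of
  \<open>X ^ ((CARD('a) - 1) div 2) - 1\<close>.\<close>

lemma euler_criterion:
  assumes "odd CARD('a :: finite_field)" and "a \<noteq> 0"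
  shows "is_square (a :: 'a) \<longleftrightarrow> a ^ ((CARD('a) - 1) div 2) = 1"
proof -
  let ?m = "(CARD('a) - 1) div 2" and ?S = "{y :: 'a. y \<noteq> 0 \<and> is_square y}"
  define R where "R = {y :: 'a. y ^ ?m = 1}"
  have "card ?S = ?m" using card_nonzero_squares[OF assms(1)] by linarith
  moreover have "CARD('a) = Suc (2 * ?m)" using assms(1) by presburger
  ultimately have m: "card ?S = ?m" "CARD('a) = Suc (2 * ?m)" by blast+
  have "CARD('a) > 1"
    using card_mono[of UNIV "{0, 1 :: 'a}"] by simp
  with m have "?m > 0" by linarith
  have "?S \<subseteq> R"
  proof
    fix y assume "y \<in> ?S"
    then obtain x where x: "y = x\<^sup>2" "x \<noteq> 0" by (auto elim: is_nth_powerE)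
    have "x * (y ^ ?m) = x ^ Suc (2 * ?m)" by (simp add: x(1) power_mult)
    also have "\<dots> = x" using finite_field_power_card_eq_same[of x] m(2) by argo
    finally have "x * (y ^ ?m) = x" .
    with x show "y \<in> R" by (simp add: R_def)
  qed
  moreover have "card R \<le> ?m"
  proof -
    let ?p = "monom 1 ?m - 1 :: 'a poly"
    have "coeff ?p ?m = 1" using \<open>?m > 0\<close> by simp
    then have "?p \<noteq> 0" by (metis coeff_0 zero_neq_one)
    moreover have "degree ?p \<le> ?m"
      by (intro degree_diff_le) (auto simp: degree_monom_le)
    moreover have "R = {y. poly ?p y = 0}" by (auto simp: R_def poly_monom)
    ultimately show ?thesis using card_poly_roots_bound[of ?p] by simp
  qed
  ultimately have "?S = R" using m(1) by (intro card_seteq) auto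
  with assms(2) show ?thesis by (auto simp: R_def)
qed

lemma half_power_cases:
  assumes "odd CARD('a :: finite_field)" and "a \<noteq> (0 :: 'a)"
  shows "a ^ ((CARD('a) - 1) div 2) = 1 \<or> a ^ ((CARD('a) - 1) div 2) = -1"
proof -
  let ?m = "(CARD('a) - 1) div 2"
  have "CARD('a) = Suc (2 * ?m)" using assms(1) by presburger
  then have "a ^ Suc (2 * ?m) = a" using finite_field_power_card_eq_same[of a] by argo
  then have "a * (a ^ ?m)\<^sup>2 = a" by (simp add: power_even_eq)
  with assms(2) have "(a ^ ?m)\<^sup>2 = 1" by simp
  then show ?thesis by (simp add: power2_eq_1_iff)
qed

text \<open>By Euler's criterion the character is the half power, which is multiplicative and takes
  only the values 1 and -1; these are distinct because 2 is nonzero.\<close>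

lemma quadratic_char_mult:
  assumes "odd CARD('a :: finite_field)"
  shows "quadratic_char (a * b :: 'a) = quadratic_char a * quadratic_char b"
proof (cases "a = 0 \<or> b = 0")
  case False
  have "1 \<noteq> (- 1 :: 'a)"
    using odd_finite_field_two_nonzero[OF assms] by (simp add: eq_neg_iff_add_eq_0)
  with False half_power_cases[OF assms, of a] half_power_cases[OF assms, of b] show ?thesis
    by (auto simp: quadratic_char_def euler_criterion[OF assms] power_mult_distrib)
qed auto

lemma quadratic_char_power2:
  assumes "a \<noteq> (0 :: 'a :: field)"
  shows "(quadratic_char a)\<^sup>2 = 1"
  using assms by (simp add: quadratic_char_def)

lemma quadratic_char_minus_1:
  assumes "odd CARD('a :: finite_field)"
  shows "quadratic_char (-1 :: 'a) = (if CARD('a) mod 4 = 1 then 1 else -1)"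
proof -
  have "1 \<noteq> (- 1 :: 'a)"
    using odd_finite_field_two_nonzero[OF assms] by (simp add: eq_neg_iff_add_eq_0)
  moreover have "even ((CARD('a) - 1) div 2) \<longleftrightarrow> CARD('a) mod 4 = 1"
    using assms by presburger
  ultimately show ?thesis
    using euler_criterion[OF assms, of "-1"]
    by (auto simp: quadratic_char_def)
qed

text \<open>Pigeonhole: the values of \<open>\<alpha> * x\<^sup>2\<close> and those of
  \<open>1 - \<beta> * y\<^sup>2\<close> each fill more than half of the field, so the two sets
  meet.\<close>

lemma diagonal_form_represents_one:
  assumes "odd CARD('a :: finite_field)" and "\<alpha> \<noteq> 0" "\<beta> \<noteq> (0 :: 'a)"
  obtains x y where "\<alpha> * x\<^sup>2 + \<beta> * y\<^sup>2 = 1"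
proof -
  let ?Q = "{y :: 'a. is_square y}"
  let ?A = "(\<lambda>z. \<alpha> * z) ` ?Q" and ?B = "(\<lambda>z. 1 - \<beta> * z) ` ?Q"
  have "?Q = insert 0 {y :: 'a. y \<noteq> 0 \<and> is_square y}" by auto
  then have "2 * card ?Q = CARD('a) + 1"
    using card_nonzero_squares[OF assms(1)] by simp
  moreover have "card ?A = card ?Q" "card ?B = card ?Q"
    using assms by (auto intro!: card_image inj_onI)
  ultimately have "card (?A \<union> ?B) < card ?A + card ?B"
    using card_mono[of UNIV "?A \<union> ?B"] by simp
  then have "?A \<inter> ?B \<noteq> {}"
    by (metis card_Un_disjoint finite_class.finite less_irrefl)
  then obtain x y where "\<alpha> * x\<^sup>2 = 1 - \<beta> * y\<^sup>2"
    by (auto elim!: is_nth_powerE)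
  then show ?thesis using that[of x y] by simp
qed

section \<open>Gauss sums of a non-trivial additive character\<close>

locale odd_field_character =
  fixes \<psi> :: "'a :: finite_field \<Rightarrow> complex" and q :: complex
  assumes odd_card: "odd CARD('a)"
    and q_eq: "q = of_nat CARD('a)"
    and additive: "additive_character \<psi>"
    and nontrivial: "\<exists>a. \<psi> a \<noteq> 1"
begin

lemma q_neq_0 [simp]: "q \<noteq> 0"
  by (simp add: q_eq)

lemma psi_0 [simp]: "\<psi> 0 = 1"
  using additive by (simp add: additive_character_def)

lemma psi_add: "\<psi> (a + b) = \<psi> a * \<psi> b"
  using additive by (simp add: additive_character_def)

lemma sum_psi: "(\<Sum>x\<in>UNIV. \<psi> x) = 0"
proof -
  obtain a where a: "\<psi> a \<noteq> 1" using nontrivial by blast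
  have "(\<Sum>x\<in>UNIV. \<psi> x) = (\<Sum>x\<in>UNIV. \<psi> (a + x))"
    by (rule sum.reindex_bij_witness[of _ "\<lambda>x. a + x" "\<lambda>x. x - a"]) auto
  also have "\<dots> = \<psi> a * (\<Sum>x\<in>UNIV. \<psi> x)"
    by (simp add: psi_add sum_distrib_left)
  finally show ?thesis using a by simp
qed

lemma sum_psi_mult: "(\<Sum>x\<in>UNIV. \<psi> (t * x)) = (if t = 0 then q else 0)"
proof (cases "t = 0")
  case False
  then have "(\<Sum>x\<in>UNIV. \<psi> (t * x)) = (\<Sum>x\<in>UNIV. \<psi> x)"
    by (intro sum.reindex_bij_witness[of _ "\<lambda>x. x / t" "\<lambda>x. t * x"]) auto
  with False show ?thesis by (simp add: sum_psi)
qed (simp add: q_eq)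

definition gauss :: complex where
  "gauss = (\<Sum>x\<in>UNIV. quadratic_char x * \<psi> x)"

lemma sum_quadratic_char_psi:
  assumes "t \<noteq> 0"
  shows "(\<Sum>x\<in>UNIV. quadratic_char x * \<psi> (t * x)) = quadratic_char t * gauss"
proof -
  have "(\<Sum>x\<in>UNIV. quadratic_char x * \<psi> (t * x)) = (\<Sum>x\<in>UNIV. quadratic_char (t * x) * quadratic_char t * \<psi> (t * x))"
    using quadratic_char_power2[OF assms]
    by (intro sum.cong) (simp_all add: quadratic_char_mult[OF odd_card] power2_eq_square)
  also have "\<dots> = (\<Sum>x\<in>UNIV. quadratic_char x * quadratic_char t * \<psi> x)"
    using assms by (intro sum.reindex_bij_witness[of _ "\<lambda>x. x / t" "\<lambda>x. t * x"]) auto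
  finally show ?thesis by (simp add: gauss_def sum_distrib_left mult_ac)
qed

definition qgauss :: "'a \<Rightarrow> complex" where
  "qgauss t = (\<Sum>x\<in>UNIV. \<psi> (t * x\<^sup>2))"

lemma qgauss_0 [simp]: "qgauss 0 = q"
  by (simp add: qgauss_def q_eq)

lemma qgauss_nonzero:
  assumes "t \<noteq> 0"
  shows "qgauss t = quadratic_char t * gauss"
  using sum_over_squares[OF odd_card, of "\<lambda>y. \<psi> (t * y)"] sum_quadratic_char_psi[OF assms] assms
  by (simp add: qgauss_def distrib_right sum.distrib sum_psi_mult)

text \<open>In the double sum for \<open>qgauss 1 * qgauss (-1)\<close>, putting
  \<open>y = x + z\<close> makes the exponent linear in \<open>x\<close> with slope
  \<open>- 2 * z\<close>. Orthogonality then leaves only \<open>z = 0\<close>, as 2 is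
  nonzero.\<close>

lemma gauss_square: "gauss\<^sup>2 = quadratic_char (-1 :: 'a) * q"
proof -
  let ?\<chi> = "quadratic_char (-1 :: 'a)"
  have two: "(2 :: 'a) \<noteq> 0" by (rule odd_finite_field_two_nonzero[OF odd_card])
  have "qgauss 1 * qgauss (-1) = (\<Sum>x\<in>UNIV. \<Sum>y\<in>UNIV. \<psi> (x\<^sup>2 - y\<^sup>2))"
    by (simp add: qgauss_def sum_product psi_add[symmetric])
  also have "\<dots> = (\<Sum>x\<in>UNIV. \<Sum>z\<in>UNIV. \<psi> (- z\<^sup>2) * \<psi> (- 2 * z * x))"
  proof (rule sum.cong[OF refl])
    fix x :: 'a
    have *: "x\<^sup>2 - (x + z)\<^sup>2 = - z\<^sup>2 + - 2 * z * x" for z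
      by (simp add: power2_eq_square algebra_simps)
    show "(\<Sum>y\<in>UNIV. \<psi> (x\<^sup>2 - y\<^sup>2)) = (\<Sum>z\<in>UNIV. \<psi> (- z\<^sup>2) * \<psi> (- 2 * z * x))"
      unfolding psi_add[symmetric]
      unfolding *[symmetric]
      by (rule sum.reindex_bij_witness[of _ "\<lambda>z. x + z" "\<lambda>y. y - x"]) simp_all
  qed
  also have "\<dots> = (\<Sum>z\<in>UNIV. \<psi> (- z\<^sup>2) * (\<Sum>x\<in>UNIV. \<psi> (- 2 * z * x)))"
    unfolding sum_distrib_left by (rule sum.swap)
  also have "\<dots> = (\<Sum>z\<in>(UNIV :: 'a set). if z = 0 then q else 0)"
    unfolding sum_psi_mult using two by (intro sum.cong) simp_all
  also have "\<dots> = q" by simp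
  finally have "?\<chi> * gauss\<^sup>2 = q"
    by (simp add: qgauss_nonzero power2_eq_square mult_ac)
  then have "?\<chi>\<^sup>2 * gauss\<^sup>2 = ?\<chi> * q"
    by (simp add: power2_eq_square mult_ac)
  then show ?thesis by (simp add: quadratic_char_power2)
qed

lemma gauss_neq_0: "gauss \<noteq> 0"
  using gauss_square q_neq_0 quadratic_char_power2[of "-1 :: 'a"] by auto

end

section \<open>Bordered matrices\<close>

lemma vec_carrier_Suc_cases:
  assumes "u \<in> carrier_vec (Suc n)"
  obtains x w where "u = vCons x w" "w \<in> carrier_vec n"
  using assms by (cases u) auto

lemma sum_carrier_vec_Suc:
  fixes f :: "'a vec \<Rightarrow> 'b :: comm_monoid_add"
  shows "(\<Sum>u\<in>carrier_vec (Suc n). f u) = (\<Sum>x\<in>UNIV. \<Sum>w\<in>carrier_vec n. f (vCons x w))"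
proof -
  have "bij_betw (\<lambda>(x, w). vCons x w) (UNIV \<times> carrier_vec n)
      (carrier_vec (Suc n) :: 'a vec set)"
    by (auto simp: bij_betw_def inj_on_def elim: vec_carrier_Suc_cases)
  then have "(\<Sum>u\<in>carrier_vec (Suc n). f u) = (\<Sum>(x, w)\<in>UNIV \<times> carrier_vec n. f (vCons x w))"
    using sum.reindex_bij_betw[of "\<lambda>(x, w). vCons x w" _ _ f] by (simp add: case_prod_unfold)
  then show ?thesis by (simp add: sum.cartesian_product)
qed

lemma carrier_vec_0_eq: "carrier_vec 0 = {0\<^sub>v 0}"
  by (auto intro!: eq_vecI)

lemma carrier_vec_Suc_eq: "carrier_vec (Suc n) = (\<lambda>(x, w). vCons x w) ` (UNIV \<times> carrier_vec n)"
  by (auto elim: vec_carrier_Suc_cases)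

lemma finite_carrier_vec [simp]: "finite (carrier_vec n :: 'a :: finite vec set)"
proof (induction n)
  case 0
  have "carrier_vec 0 \<subseteq> {vNil :: 'a vec}" by auto
  then show ?case by (rule finite_subset) simp
next
  case (Suc n)
  then show ?case by (auto simp: carrier_vec_Suc_eq)
qed

lemma card_carrier_vec: "card (carrier_vec n :: 'a :: {finite, zero} vec set) = CARD('a) ^ n"
proof (induction n)
  case (Suc n)
  have "inj_on (\<lambda>(x, w). vCons x w) (UNIV \<times> carrier_vec n :: ('a \<times> 'a vec) set)"
    by (auto simp: inj_on_def)
  with Suc show ?case by (simp add: carrier_vec_Suc_eq card_image card_cartesian_product)
qed (simp add: carrier_vec_0_eq)

text \<open>Products of bordered matrices are compared by their action on vectors
  \<open>vCons x u\<close>, where \<open>bordered_mult_vec\<close> computes blockwise and entries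
  need not be expanded.\<close>

lemma eq_mat_by_mult_vec:
  fixes A B :: "'a :: semiring_1 mat"
  assumes A: "A \<in> carrier_mat m n" and B: "B \<in> carrier_mat m n"
    and eq: "\<And>v. v \<in> carrier_vec n \<Longrightarrow> A *\<^sub>v v = B *\<^sub>v v"
  shows "A = B"
proof (rule eq_matI)
  fix i j assume "i < dim_row B" "j < dim_col B"
  with A B have ij: "i < m" "j < n" by auto
  have "(A *\<^sub>v unit_vec n j) $ i = (B *\<^sub>v unit_vec n j) $ i" using eq by simp
  with A B ij show "A $$ (i, j) = B $$ (i, j)" by simp
qed (use A B in auto)

lemma invertible_mat_by_kernel:
  fixes g :: "'a :: field mat"
  assumes g: "g \<in> carrier_mat n n"
    and ker: "\<And>v. v \<in> carrier_vec n \<Longrightarrow> g *\<^sub>v v = 0\<^sub>v n \<Longrightarrow> v = 0\<^sub>v n"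
  shows "invertible_mat g"
proof -
  have "det g \<noteq> 0" using det_0_iff_vec_prod_zero_field[OF g] ker by blast
  from det_non_zero_imp_unit[OF g this] obtain h where "h \<in> carrier_mat n n"
    "g * h = 1\<^sub>m n" "h * g = 1\<^sub>m n"
    unfolding Units_def by (auto simp: ring_mat_def)
  with g show ?thesis by (auto simp: invertible_mat_def inverts_mat_def)
qed

lemma invertible_matE:
  assumes g: "g \<in> carrier_mat n n" and "invertible_mat g"
  obtains h where "h \<in> carrier_mat n n" "g * h = 1\<^sub>m n" "h * g = 1\<^sub>m n"
proof -
  obtain h where "g * h = 1\<^sub>m n" and h: "h * g = 1\<^sub>m (dim_row h)"
    using assms by (auto simp: invertible_mat_def inverts_mat_def)
  moreover from this g have "h \<in> carrier_mat n n"
    by (metis carrier_matD(2) carrier_matI index_mult_mat(2,3) index_one_mat(2,3))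
  ultimately show ?thesis using that by auto
qed

lemma bij_betw_mult_mat_vec:
  assumes g: "g \<in> carrier_mat n n" and "invertible_mat g"
  shows "bij_betw (\<lambda>v. g *\<^sub>v v) (carrier_vec n) (carrier_vec n)"
proof -
  obtain h where h: "h \<in> carrier_mat n n" "g * h = 1\<^sub>m n" "h * g = 1\<^sub>m n"
    using invertible_matE[OF assms] .
  show ?thesis
    using g h
    by (intro bij_betw_byWitness[where f' = "\<lambda>v. h *\<^sub>v v"])
      (auto simp flip: assoc_mult_mat_vec)
qed

lemma invertible_mat_transpose:
  assumes g: "g \<in> carrier_mat n n" and "invertible_mat (g :: 'a :: field mat)"
  shows "invertible_mat (transpose_mat g)"
proof -
  obtain h where h: "h \<in> carrier_mat n n" "g * h = 1\<^sub>m n" "h * g = 1\<^sub>m n"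
    using invertible_matE[OF assms] .
  then have "transpose_mat g * transpose_mat h = 1\<^sub>m n" "transpose_mat h * transpose_mat g = 1\<^sub>m n"
    using g by (metis transpose_mult transpose_one)+
  with g h(1) show ?thesis by (auto simp: invertible_mat_def inverts_mat_def)
qed

lemma invertible_mat_mult:
  assumes "g \<in> carrier_mat n n" "invertible_mat (g :: 'a :: field mat)"
    and "g' \<in> carrier_mat n n" "invertible_mat g'"
  shows "invertible_mat (g * g')"
proof (rule invertible_mat_by_kernel)
  show "g * g' \<in> carrier_mat n n" using assms by simp
  fix v :: "'a vec" assume v: "v \<in> carrier_vec n" "(g * g') *\<^sub>v v = 0\<^sub>v n"
  moreover have "h *\<^sub>v 0\<^sub>v n = 0\<^sub>v n" if "h \<in> carrier_mat n n" for h :: "'a mat"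
    using that by (intro eq_vecI) auto
  ultimately have "g *\<^sub>v (g' *\<^sub>v v) = g *\<^sub>v (g' *\<^sub>v 0\<^sub>v n)" using assms by simp
  then have "g' *\<^sub>v v = g' *\<^sub>v 0\<^sub>v n"
    using bij_betw_mult_mat_vec[OF assms(1,2)] assms v
    by (metis bij_betw_imp_inj_on inj_on_def mult_mat_vec_carrier zero_carrier_vec)
  then show "v = 0\<^sub>v n"
    using bij_betw_mult_mat_vec[OF assms(3,4)] assms v
    by (metis bij_betw_imp_inj_on inj_on_def zero_carrier_vec)
qed

text \<open>Complete \<open>u\<close> to a basis starting with \<open>u\<close> and take the basis
  vectors as columns.\<close>

lemma ex_invertible_mat_first_col:
  fixes u :: "'a :: field vec"
  assumes u: "u \<in> carrier_vec n" "u \<noteq> 0\<^sub>v n"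
  obtains g where "g \<in> carrier_mat n n" "invertible_mat g" "g *\<^sub>v unit_vec n 0 = u"
proof -
  interpret vec_space "TYPE('a)" n .
  let ?b = "basis_completion u"
  define g where "g = mat_of_cols n ?b"
  note b = basis_completion[OF u]
  have g: "g \<in> carrier_mat n n"
    unfolding g_def using b(6) by (metis mat_of_cols_carrier(1))
  have "n > 0" using u by (cases n) auto
  have cols: "cols g = ?b" unfolding g_def using b(2) by (rule cols_mat_of_cols)
  have "invertible_mat g"
    using lin_depI[OF g] b(4,5) unfolding cols by (intro invertible_mat_by_kernel[OF g]) blast
  moreover have "g *\<^sub>v unit_vec n 0 = col g 0"
    using g \<open>n > 0\<close> by (intro eq_vecI) auto
  moreover have "col g 0 = u"
    using b(6,7) \<open>n > 0\<close> g cols by (metis carrier_matD(2) cols_nth hd_conv_nth length_0_conv less_numeral_extra(3))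
  ultimately show ?thesis using that[OF g] by simp
qed

text \<open>Corner \<open>\<alpha>\<close>, then the rest \<open>w\<close> of the first row and the
  rest \<open>v\<close> of the first column. Row and column are independent because the elimination
  matrices used as congruences are lower triangular, not symmetric.\<close>

definition bordered :: "'a :: semiring_0 \<Rightarrow> 'a vec \<Rightarrow> 'a vec \<Rightarrow> 'a mat \<Rightarrow> 'a mat" where
  "bordered \<alpha> w v c = mat (Suc (dim_row c)) (Suc (dim_col c)) (\<lambda>(i, j).
     if i = 0 then vCons \<alpha> w $ j else if j = 0 then v $ (i - 1) else c $$ (i - 1, j - 1))"

lemma bordered_carrier [simp]:
  "c \<in> carrier_mat m n \<Longrightarrow> bordered \<alpha> w v c \<in> carrier_mat (Suc m) (Suc n)"
  by (auto simp: bordered_def)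

lemma bordered_dim [simp]:
  "dim_row (bordered \<alpha> w v c) = Suc (dim_row c)" "dim_col (bordered \<alpha> w v c) = Suc (dim_col c)"
  by (simp_all add: bordered_def)

lemma bordered_mult_vec:
  fixes c :: "'a :: comm_ring_1 mat"
  assumes "c \<in> carrier_mat m n" "w \<in> carrier_vec n" "v \<in> carrier_vec m" "u \<in> carrier_vec n"
  shows "bordered \<alpha> w v c *\<^sub>v vCons x u = vCons (\<alpha> * x + w \<bullet> u) (x \<cdot>\<^sub>v v + c *\<^sub>v u)"
proof (rule eq_vecI)
  fix i assume i: "i < dim_vec (vCons (\<alpha> * x + w \<bullet> u) (x \<cdot>\<^sub>v v + c *\<^sub>v u))"
  show "(bordered \<alpha> w v c *\<^sub>v vCons x u) $ i = vCons (\<alpha> * x + w \<bullet> u) (x \<cdot>\<^sub>v v + c *\<^sub>v u) $ i"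
  proof (cases i)
    case 0
    have "row (bordered \<alpha> w v c) 0 = vCons \<alpha> w"
      using assms by (intro eq_vecI) (auto simp: bordered_def)
    with 0 i show ?thesis by simp
  next
    case (Suc j)
    have "row (bordered \<alpha> w v c) i = vCons (v $ j) (row c j)"
      using assms i Suc by (intro eq_vecI) (auto simp: bordered_def vec_index_vCons)
    with Suc i assms show ?thesis by simp
  qed
qed (use assms in auto)

lemma transpose_bordered:
  assumes "c \<in> carrier_mat m n" "w \<in> carrier_vec n" "v \<in> carrier_vec m"
  shows "transpose_mat (bordered \<alpha> w v c) = bordered \<alpha> v w (transpose_mat c)"
  using assms by (intro eq_matI) (auto simp: bordered_def vec_index_vCons)

lemma bordered_inject:
  assumes "c \<in> carrier_mat m n" "w \<in> carrier_vec n" "v \<in> carrier_vec m"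
    and "c' \<in> carrier_mat m n" "w' \<in> carrier_vec n" "v' \<in> carrier_vec m"
    and eq: "bordered \<alpha> w v c = bordered \<alpha>' w' v' c'"
  shows "\<alpha> = \<alpha>' \<and> w = w' \<and> v = v' \<and> c = c'"
proof -
  have entry: "bordered \<alpha> w v c $$ (i, j) = bordered \<alpha>' w' v' c' $$ (i, j)" for i j
    by (simp add: eq)
  have \<alpha>: "\<alpha> = \<alpha>'" using entry[of 0 0] assms by (simp add: bordered_def)
  have "w $ j = w' $ j" if "j < n" for j
    using entry[of 0 "Suc j"] assms that by (simp add: bordered_def)
  then have w: "w = w'" using assms by (intro eq_vecI) auto
  have "v $ i = v' $ i" if "i < m" for i
    using entry[of "Suc i" 0] assms that by (simp add: bordered_def)
  then have v: "v = v'" using assms by (intro eq_vecI) auto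
  have "c $$ (i, j) = c' $$ (i, j)" if "i < m" "j < n" for i j
    using entry[of "Suc i" "Suc j"] assms that by (simp add: bordered_def)
  then have c: "c = c'" using assms by (intro eq_matI) auto
  from \<alpha> w v c show ?thesis by simp
qed

lemma bordered_exhaust:
  assumes "a \<in> carrier_mat (Suc m) (Suc n)"
  obtains \<alpha> w v c where "a = bordered \<alpha> w v c" "w \<in> carrier_vec n" "v \<in> carrier_vec m" "c \<in> carrier_mat m n"
proof
  show "a = bordered (a $$ (0, 0)) (vec n (\<lambda>j. a $$ (0, Suc j))) (vec m (\<lambda>i. a $$ (Suc i, 0)))
      (mat m n (\<lambda>(i, j). a $$ (Suc i, Suc j)))"
    using assms by (intro eq_matI) (auto simp: bordered_def vec_index_vCons)
qed auto

lemma Sym_carrier: "a \<in> Sym n \<Longrightarrow> a \<in> carrier_mat n n"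
  by (simp add: Sym_def)

lemma Sym_exhaust:
  assumes "a \<in> Sym (Suc n)"
  obtains \<alpha> v c where "a = bordered \<alpha> v v c" "v \<in> carrier_vec n" "c \<in> Sym n"
proof -
  obtain \<alpha> w v c where a: "a = bordered \<alpha> w v c" "w \<in> carrier_vec n" "v \<in> carrier_vec n"
    "c \<in> carrier_mat n n"
    using bordered_exhaust Sym_carrier[OF assms] by metis
  then have "bordered \<alpha> v w (transpose_mat c) = bordered \<alpha> w v c"
    using assms by (simp add: Sym_def transpose_bordered)
  from bordered_inject[OF _ _ _ _ _ _ this] a that[of \<alpha> v c] show ?thesis
    by (auto simp: Sym_def)
qed

lemma bordered_Sym [simp]: "v \<in> carrier_vec n \<Longrightarrow> c \<in> Sym n \<Longrightarrow> bordered \<alpha> v v c \<in> Sym (Suc n)"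
  by (simp add: Sym_def transpose_bordered[of _ n n])

lemma mat_diag_Suc:
  "mat_diag (Suc n) f = bordered (f 0) (0\<^sub>v n) (0\<^sub>v n) (mat_diag n (\<lambda>i. f (Suc i)))"
  by (intro eq_matI) (auto simp: mat_diag_def bordered_def vec_index_vCons)

section \<open>Rank and congruence\<close>

lemma mult_mat_zero_vec [simp]:
  fixes a :: "'a :: semiring_0 mat"
  assumes "a \<in> carrier_mat m n"
  shows "a *\<^sub>v 0\<^sub>v n = 0\<^sub>v m"
  using assms by (intro eq_vecI) auto

lemma zero_mat_mult_vec [simp]:
  fixes u :: "'a :: semiring_0 vec"
  assumes "u \<in> carrier_vec n"
  shows "0\<^sub>m m n *\<^sub>v u = 0\<^sub>v m"
  using assms by (intro eq_vecI) auto

lemma smult_zero_vec [simp]: "(x :: 'a :: mult_zero) \<cdot>\<^sub>v 0\<^sub>v n = 0\<^sub>v n"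
  by (intro eq_vecI) auto

lemma mult_mat3_vec:
  fixes a :: "'a :: comm_ring_1 mat"
  assumes "a \<in> carrier_mat n n" "b \<in> carrier_mat n n" "c \<in> carrier_mat n n" "u \<in> carrier_vec n"
  shows "(a * b * c) *\<^sub>v u = a *\<^sub>v (b *\<^sub>v (c *\<^sub>v u))"
proof -
  have "(a * b * c) *\<^sub>v u = (a * b) *\<^sub>v (c *\<^sub>v u)"
    using assms by (intro assoc_mult_mat_vec[of _ n n _ n]) auto
  also have "\<dots> = a *\<^sub>v (b *\<^sub>v (c *\<^sub>v u))"
    using assms by (intro assoc_mult_mat_vec[of _ n n _ n]) auto
  finally show ?thesis .
qed

lemma smult_mat_mult_vec:
  fixes a :: "'a :: comm_ring_1 mat"
  assumes "a \<in> carrier_mat m n" "u \<in> carrier_vec n"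
  shows "(t \<cdot>\<^sub>m a) *\<^sub>v u = t \<cdot>\<^sub>v (a *\<^sub>v u)"
  using assms by (intro eq_vecI) auto

lemma quadratic_form_add:
  fixes a :: "'a :: comm_ring_1 mat"
  assumes a: "a \<in> carrier_mat n n" and u: "u \<in> carrier_vec n" and w: "w \<in> carrier_vec n"
  shows "(u + w) \<bullet> (a *\<^sub>v (u + w)) =
    u \<bullet> (a *\<^sub>v u) + u \<bullet> (a *\<^sub>v w) + (w \<bullet> (a *\<^sub>v u) + w \<bullet> (a *\<^sub>v w))"
proof -
  have au: "a *\<^sub>v u \<in> carrier_vec n" and aw: "a *\<^sub>v w \<in> carrier_vec n" using a u w by auto
  show ?thesis
    unfolding mult_add_distrib_mat_vec[OF a u w] add_scalar_prod_distrib[OF u w add_carrier_vec[OF au aw]]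
      scalar_prod_add_distrib[OF u au aw] scalar_prod_add_distrib[OF w au aw] ..
qed

lemma unit_vec_mult_mat_vec:
  fixes a :: "'a :: semiring_1 mat"
  assumes "a \<in> carrier_mat m n" "i < m" "j < n"
  shows "unit_vec m i \<bullet> (a *\<^sub>v unit_vec n j) = a $$ (i, j)"
  using assms by simp

text \<open>Coordinates in a finite basis are unique, so vectors correspond to functions from the
  basis to the scalars.\<close>

lemma (in vectorspace) card_carrier_fin_dim:
  assumes "fin_dim"
  shows "card (carrier V) = card (carrier K) ^ dim"
proof -
  obtain B where B: "finite B" "basis B" using finite_basis_exists[OF assms] by blast
  then have BV: "B \<subseteq> carrier V" by (simp add: basis_def)
  have "\<forall>v. v \<in> carrier V \<longrightarrow> (\<exists>!a. a \<in> B \<rightarrow>\<^sub>E carrier K \<and> lincomb a B = v)"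
    using basis_criterion[OF B(1) BV] B(2) by blast
  moreover have "lincomb a B \<in> carrier V" if "a \<in> B \<rightarrow>\<^sub>E carrier K" for a
    using that BV by (intro lincomb_closed) auto
  ultimately have "bij_betw (\<lambda>a. lincomb a B) (B \<rightarrow>\<^sub>E carrier K) (carrier V)"
    by (intro bij_betwI') (blast, blast, metis)
  then have "card (carrier V) = card (B \<rightarrow>\<^sub>E carrier K)"
    by (simp add: bij_betw_same_card)
  with B show ?thesis by (simp add: card_PiE dim_basis)
qed

text \<open>The image is the column space. Ranks can thus be found by counting images, which makes
  congruence invariance and additivity over diagonal blocks statements about bijections.\<close>

lemma card_range_mult_vec:
  fixes a :: "'a :: {finite, field} mat"
  assumes a: "a \<in> carrier_mat n m"
  shows "card ((\<lambda>u. a *\<^sub>v u) ` carrier_vec m) = CARD('a) ^ vec_space.rank n a"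
proof -
  interpret vec_space "TYPE('a)" n .
  have cols: "set (cols a) \<subseteq> carrier V" using cols_dim[of a] carrier_matD(1)[OF a] by simp
  interpret span: vectorspace class_ring "span_vs (set (cols a))"
    using cols span_is_subspace subspace_def subspace_is_vs by simp
  have "card (span (set (cols a))) = CARD('a) ^ rank a"
    using span.card_carrier_fin_dim fin_dim_span_cols[OF a] by (simp add: rank_def)
  moreover have "span (set (cols a)) = (\<lambda>u. a *\<^sub>v u) ` carrier_vec m"
    using col_space_eq[OF a] a by (auto simp: col_space_def)
  ultimately show ?thesis by simp
qed

lemma card_field_power_eq_iff [simp]:
  "CARD('a :: {finite, field}) ^ m = CARD('a) ^ k \<longleftrightarrow> m = k"
proof -
  have "1 < CARD('a)" using card_mono[of UNIV "{0, 1 :: 'a}"] by simp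
  then show ?thesis by simp
qed

lemma rank_eqI:
  fixes a :: "'a :: {finite, field} mat"
  assumes "a \<in> carrier_mat n m" and "card ((\<lambda>u. a *\<^sub>v u) ` carrier_vec m) = CARD('a) ^ k"
  shows "vec_space.rank n a = k"
  using card_range_mult_vec[OF assms(1)] assms(2) by simp

lemma rank_zero_mat: "vec_space.rank n (0\<^sub>m n n :: 'a :: {finite, field} mat) = 0"
proof (rule rank_eqI)
  have "(\<lambda>u. 0\<^sub>m n n *\<^sub>v u) ` carrier_vec n = {0\<^sub>v n :: 'a vec}"
    by (subst image_cong[OF refl zero_mat_mult_vec]) (auto intro: image_constant zero_carrier_vec)
  then show "card ((\<lambda>u. 0\<^sub>m n n *\<^sub>v u) ` (carrier_vec n :: 'a vec set)) = CARD('a) ^ 0" by simp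
qed simp

lemma bordered_diag_mult_vec:
  fixes c :: "'a :: comm_ring_1 mat"
  assumes c: "c \<in> carrier_mat m n" and u: "u \<in> carrier_vec n"
  shows "bordered \<alpha> (0\<^sub>v n) (0\<^sub>v m) c *\<^sub>v vCons x u = vCons (\<alpha> * x) (c *\<^sub>v u)"
proof -
  have "x \<cdot>\<^sub>v 0\<^sub>v m + c *\<^sub>v u = c *\<^sub>v u" using c u by (intro eq_vecI) auto
  then show ?thesis using bordered_mult_vec[OF c, of "0\<^sub>v n" "0\<^sub>v m" u \<alpha> x] u by simp
qed

lemma rank_bordered_diag:
  fixes c :: "'a :: {finite, field} mat"
  assumes c: "c \<in> carrier_mat n n"
  shows "vec_space.rank (Suc n) (bordered \<alpha> (0\<^sub>v n) (0\<^sub>v n) c) =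
    (if \<alpha> = 0 then 0 else 1) + vec_space.rank n c"
proof (rule rank_eqI)
  let ?R = "(\<lambda>u. c *\<^sub>v u) ` carrier_vec n" and ?X = "if \<alpha> = 0 then {0} else UNIV :: 'a set"
  have X: "range (\<lambda>x. \<alpha> * x) = ?X" by (auto simp: image_iff) (metis nonzero_mult_div_cancel_left times_divide_eq_right)
  have "(\<lambda>u. bordered \<alpha> (0\<^sub>v n) (0\<^sub>v n) c *\<^sub>v u) ` carrier_vec (Suc n) =
      (\<lambda>(x, u). vCons (\<alpha> * x) (c *\<^sub>v u)) ` (UNIV \<times> carrier_vec n)"
    unfolding carrier_vec_Suc_eq image_image
    by (intro image_cong) (auto simp: bordered_diag_mult_vec[OF c])
  also have "\<dots> = (\<lambda>(x, u). vCons x u) ` (range (\<lambda>x. \<alpha> * x) \<times> ?R)" by force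
  also have "card \<dots> = card (range (\<lambda>x. \<alpha> * x) \<times> ?R)"
    by (intro card_image) (auto simp: inj_on_def)
  finally have "card ((\<lambda>u. bordered \<alpha> (0\<^sub>v n) (0\<^sub>v n) c *\<^sub>v u) ` carrier_vec (Suc n)) = card (?X \<times> ?R)"
    unfolding X .
  then show "card ((\<lambda>u. bordered \<alpha> (0\<^sub>v n) (0\<^sub>v n) c *\<^sub>v u) ` carrier_vec (Suc n)) =
      CARD('a) ^ ((if \<alpha> = 0 then 0 else 1) + vec_space.rank n c)"
    using card_range_mult_vec[OF c] by (simp add: card_cartesian_product)
qed (use c in simp)

lemma in_orbit_refl:
  fixes a :: "'a :: field mat"
  assumes "a \<in> carrier_mat n n"
  shows "in_orbit n a a"
  unfolding in_orbit_def
  using assms by (intro bexI[of _ "1\<^sub>m n"]) (auto intro!: invertible_mat_by_kernel)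

lemma in_orbit_trans:
  fixes a b c :: "'a :: field mat"
  assumes "in_orbit n a b" "in_orbit n b c" and c: "c \<in> carrier_mat n n"
  shows "in_orbit n a c"
proof -
  obtain g h where g: "g \<in> carrier_mat n n" "invertible_mat g" "a = g * b * transpose_mat g"
    and h: "h \<in> carrier_mat n n" "invertible_mat h" "b = h * c * transpose_mat h"
    using assms(1,2) by (auto simp: in_orbit_def)
  have "a = (g * h) * c * transpose_mat (g * h)"
    using g(1) h(1) c unfolding g(3) h(3)
    by (simp add: transpose_mult[of _ n n _ n] assoc_mult_mat[of _ n n _ n _ n])
  with g h invertible_mat_mult show ?thesis unfolding in_orbit_def by (metis mult_carrier_mat)
qed

lemma in_orbit_sym:
  fixes a b :: "'a :: field mat"
  assumes "in_orbit n a b" and b: "b \<in> carrier_mat n n"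
  shows "in_orbit n b a"
proof -
  obtain g where g: "g \<in> carrier_mat n n" "invertible_mat g" "a = g * b * transpose_mat g"
    using assms(1) by (auto simp: in_orbit_def)
  obtain h where h: "h \<in> carrier_mat n n" "g * h = 1\<^sub>m n" "h * g = 1\<^sub>m n"
    using invertible_matE[OF g(1,2)] .
  have t: "transpose_mat g * transpose_mat h = 1\<^sub>m n"
    using g h by (metis transpose_mult transpose_one)
  have "h * a * transpose_mat h = (h * g) * b * (transpose_mat g * transpose_mat h)"
    using g(1) h(1) b unfolding g(3) by (simp add: assoc_mult_mat[of _ n n _ n _ n])
  then have "b = h * a * transpose_mat h" using b h t by simp
  moreover have "invertible_mat h" using g h by (auto simp: invertible_mat_def inverts_mat_def)
  ultimately show ?thesis using h(1) by (auto simp: in_orbit_def)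
qed

lemma in_orbit_Sym:
  assumes "in_orbit n a b" "b \<in> Sym n"
  shows "a \<in> Sym n"
proof -
  obtain g where g: "g \<in> carrier_mat n n" "a = g * b * transpose_mat g"
    using assms(1) by (auto simp: in_orbit_def)
  have "b \<in> carrier_mat n n" "transpose_mat b = b" using assms(2) by (auto simp: Sym_def)
  with g show ?thesis
    by (auto simp: Sym_def transpose_mult[of _ n n _ n] assoc_mult_mat[of _ n n _ n _ n])
qed

lemma rank_in_orbit:
  fixes a b :: "'a :: {finite, field} mat"
  assumes "in_orbit n a b" and b: "b \<in> carrier_mat n n"
  shows "vec_space.rank n a = vec_space.rank n b"
proof (rule rank_eqI)
  obtain g where g: "g \<in> carrier_mat n n" "invertible_mat g" "a = g * b * transpose_mat g"
    using assms(1) by (auto simp: in_orbit_def)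
  show "a \<in> carrier_mat n n" using g b by auto
  have "(\<lambda>u. a *\<^sub>v u) ` carrier_vec n =
      (\<lambda>u. g *\<^sub>v u) ` (\<lambda>u. b *\<^sub>v u) ` (\<lambda>u. transpose_mat g *\<^sub>v u) ` carrier_vec n"
    unfolding image_image g(3)
    using g(1) b by (intro image_cong refl mult_mat3_vec[of _ n]) auto
  also have "(\<lambda>u. transpose_mat g *\<^sub>v u) ` carrier_vec n = carrier_vec n"
    using g by (intro bij_betw_imp_surj_on bij_betw_mult_mat_vec invertible_mat_transpose) auto
  also have "card ((\<lambda>u. g *\<^sub>v u) ` (\<lambda>u. b *\<^sub>v u) ` carrier_vec n) = card ((\<lambda>u. b *\<^sub>v u) ` carrier_vec n)"
    using bij_betw_mult_mat_vec[OF g(1,2)] b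
    by (intro card_image) (auto simp: bij_betw_def intro: inj_on_subset)
  finally show "card ((\<lambda>u. a *\<^sub>v u) ` carrier_vec n) = CARD('a) ^ vec_space.rank n b"
    using card_range_mult_vec[OF b] by simp
qed

lemma invertible_bordered:
  fixes h :: "'a :: field mat"
  assumes "t \<noteq> 0" and v: "v \<in> carrier_vec n" and h: "h \<in> carrier_mat n n" "invertible_mat h"
  shows "invertible_mat (bordered t (0\<^sub>v n) v h)"
proof (rule invertible_mat_by_kernel)
  fix z assume z: "z \<in> carrier_vec (Suc n)" "bordered t (0\<^sub>v n) v h *\<^sub>v z = 0\<^sub>v (Suc n)"
  then obtain x u where xu: "z = vCons x u" "u \<in> carrier_vec n" by (metis vec_carrier_Suc_cases)
  with z v h have "vCons (t * x) (x \<cdot>\<^sub>v v + h *\<^sub>v u) = vCons 0 (0\<^sub>v n)"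
    by (simp add: bordered_mult_vec zero_vec_Suc)
  with \<open>t \<noteq> 0\<close> have "x = 0" "0 \<cdot>\<^sub>v v + h *\<^sub>v u = 0\<^sub>v n" by auto
  moreover from this(2) have "h *\<^sub>v u = h *\<^sub>v 0\<^sub>v n"
    using v h xu by (auto simp: vec_eq_iff)
  then have "u = 0\<^sub>v n"
    using bij_betw_mult_mat_vec[OF h] xu(2) by (metis bij_betw_imp_inj_on inj_on_def zero_carrier_vec)
  ultimately show "z = 0\<^sub>v (Suc n)" using xu by (simp add: zero_vec_Suc)
qed (use v h in simp)

text \<open>The witness is block diagonal, \<open>t\<close> in the corner next to the witness for
  \<open>c\<close>: a diagonal entry matters only up to nonzero squares.\<close>

lemma in_orbit_bordered_diag:
  fixes c d :: "'a :: field mat"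
  assumes "t \<noteq> 0" and orbit: "in_orbit n c d" and d: "d \<in> carrier_mat n n"
  shows "in_orbit (Suc n) (bordered (\<alpha> * t\<^sup>2) (0\<^sub>v n) (0\<^sub>v n) c) (bordered \<alpha> (0\<^sub>v n) (0\<^sub>v n) d)"
proof -
  obtain h where h: "h \<in> carrier_mat n n" "invertible_mat h" and c: "c = h * d * transpose_mat h"
    using orbit by (auto simp: in_orbit_def)
  let ?g = "bordered t (0\<^sub>v n) (0\<^sub>v n) h"
  have g: "?g \<in> carrier_mat (Suc n) (Suc n)" "invertible_mat ?g"
    using h \<open>t \<noteq> 0\<close> by (auto intro: invertible_bordered)
  have "bordered (\<alpha> * t\<^sup>2) (0\<^sub>v n) (0\<^sub>v n) c = ?g * bordered \<alpha> (0\<^sub>v n) (0\<^sub>v n) d * transpose_mat ?g"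
  proof (rule eq_mat_by_mult_vec[of _ "Suc n" "Suc n"])
    fix z :: "'a vec" assume "z \<in> carrier_vec (Suc n)"
    then obtain x u where "z = vCons x u" "u \<in> carrier_vec n" by (rule vec_carrier_Suc_cases)
    then show "bordered (\<alpha> * t\<^sup>2) (0\<^sub>v n) (0\<^sub>v n) c *\<^sub>v z =
        (?g * bordered \<alpha> (0\<^sub>v n) (0\<^sub>v n) d * transpose_mat ?g) *\<^sub>v z"
      using h d mult_carrier_mat[OF mult_carrier_mat[OF h(1) d], of "transpose_mat h" n]
      by (simp add: c transpose_bordered[of _ n n] mult_mat3_vec[of _ "Suc n"] mult_mat3_vec[of _ n]
          bordered_diag_mult_vec[of _ n n] power2_eq_square mult_ac del: assoc_mult_mat)
  qed (use g h d c in auto)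
  with g show ?thesis unfolding in_orbit_def by blast
qed

definition outer :: "'a :: semiring_0 vec \<Rightarrow> 'a vec \<Rightarrow> 'a mat" where
  "outer v w = mat (dim_vec v) (dim_vec w) (\<lambda>(i, j). v $ i * w $ j)"

lemma outer_carrier [simp]: "v \<in> carrier_vec m \<Longrightarrow> w \<in> carrier_vec n \<Longrightarrow> outer v w \<in> carrier_mat m n"
  by (auto simp: outer_def)

lemma outer_Sym [simp]: "v \<in> carrier_vec n \<Longrightarrow> outer v v \<in> Sym n"
  by (auto simp: Sym_def outer_def mult.commute intro!: eq_matI)

lemma outer_mult_vec:
  fixes v w u :: "'a :: comm_ring_1 vec"
  assumes "v \<in> carrier_vec m" "w \<in> carrier_vec n" "u \<in> carrier_vec n"
  shows "outer v w *\<^sub>v u = (w \<bullet> u) \<cdot>\<^sub>v v"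
  using assms
  by (intro eq_vecI) (auto simp: outer_def scalar_prod_def sum_distrib_left sum_distrib_right mult_ac)

text \<open>Eliminating the border with the pivot \<open>\<alpha>\<close>. The statement starts from
  the complement \<open>c\<close> rather than from the lower block, so that \<open>c\<close> can
  serve as the summation variable after a shift by a multiple of \<open>outer v v\<close>.\<close>

lemma in_orbit_schur_complement:
  fixes c :: "'a :: field mat"
  assumes "\<alpha> \<noteq> 0" and v: "v \<in> carrier_vec n" and c: "c \<in> carrier_mat n n"
  shows "in_orbit (Suc n) (bordered \<alpha> v v (c + inverse \<alpha> \<cdot>\<^sub>m outer v v)) (bordered \<alpha> (0\<^sub>v n) (0\<^sub>v n) c)"
proof -
  let ?w = "inverse \<alpha> \<cdot>\<^sub>v v" and ?d = "bordered \<alpha> (0\<^sub>v n) (0\<^sub>v n) c"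
  let ?g = "bordered 1 (0\<^sub>v n) ?w (1\<^sub>m n)" and ?s = "c + inverse \<alpha> \<cdot>\<^sub>m outer v v"
  have w: "?w \<in> carrier_vec n" using v by simp
  have g: "?g \<in> carrier_mat (Suc n) (Suc n)" "invertible_mat ?g"
    using w by (auto intro!: invertible_bordered invertible_mat_by_kernel[of "1\<^sub>m n"])
  have s: "?s \<in> carrier_mat n n" using c v by simp
  have "bordered \<alpha> v v ?s = ?g * ?d * transpose_mat ?g"
  proof (rule eq_mat_by_mult_vec[of _ "Suc n" "Suc n"])
    fix z :: "'a vec" assume "z \<in> carrier_vec (Suc n)"
    then obtain x u where z: "z = vCons x u" and u: "u \<in> carrier_vec n"
      by (rule vec_carrier_Suc_cases)
    have "transpose_mat ?g *\<^sub>v z = vCons (x + ?w \<bullet> u) u"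
      using u v w unfolding z
      by (subst transpose_bordered[of _ n n]; simp?; subst bordered_mult_vec[of _ n n]; (simp)?)
    then have "(?g * ?d * transpose_mat ?g) *\<^sub>v z = ?g *\<^sub>v vCons (\<alpha> * (x + ?w \<bullet> u)) (c *\<^sub>v u)"
      using c u v w g z
      by (simp add: mult_mat3_vec[of _ "Suc n"] bordered_diag_mult_vec[of _ n n] del: assoc_mult_mat)
    also have "\<dots> = vCons (\<alpha> * (x + ?w \<bullet> u)) ((\<alpha> * (x + ?w \<bullet> u)) \<cdot>\<^sub>v ?w + c *\<^sub>v u)"
      using c u w by (subst bordered_mult_vec[of _ n n]) auto
    also have "\<alpha> * (x + ?w \<bullet> u) = \<alpha> * x + v \<bullet> u"
      using \<open>\<alpha> \<noteq> 0\<close> u v by (simp add: field_simps)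
    also have "(\<alpha> * x + v \<bullet> u) \<cdot>\<^sub>v ?w + c *\<^sub>v u = x \<cdot>\<^sub>v v + ?s *\<^sub>v u"
      using \<open>\<alpha> \<noteq> 0\<close> u v c
      by (intro eq_vecI) (auto simp: add_mult_distrib_mat_vec[of _ n n] outer_mult_vec[of _ n] 
          smult_mat_mult_vec[of _ n n] field_simps)
    also have "vCons (\<alpha> * x + v \<bullet> u) (x \<cdot>\<^sub>v v + ?s *\<^sub>v u) = bordered \<alpha> v v ?s *\<^sub>v z"
      using u v s unfolding z by (simp add: bordered_mult_vec[of _ n n])
    finally show "bordered \<alpha> v v ?s *\<^sub>v z = (?g * ?d * transpose_mat ?g) *\<^sub>v z" by simp
  qed (use g c s in auto)
  with g show ?thesis unfolding in_orbit_def by blast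
qed

lemma transpose_smult_mat: "transpose_mat (t \<cdot>\<^sub>m a) = t \<cdot>\<^sub>m transpose_mat a"
  by (intro eq_matI) auto

lemma Sym_closed:
  assumes "a \<in> Sym n"
  shows "b \<in> Sym n \<Longrightarrow> a + b \<in> Sym n" "b \<in> Sym n \<Longrightarrow> a - b \<in> Sym n" "t \<cdot>\<^sub>m a \<in> Sym n"
  using assms by (auto simp: Sym_def transpose_add[of _ n n] transpose_minus[of _ n n] transpose_smult_mat)

lemma Sym_congruence:
  assumes "a \<in> Sym n" "g \<in> carrier_mat n n"
  shows "transpose_mat g * a * g \<in> Sym n"
  using assms by (auto simp: Sym_def transpose_mult[of _ n n _ n] assoc_mult_mat[of _ n n _ n _ n])

text \<open>A basis change that makes \<open>u\<close> the first basis vector puts the value of the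
  form at \<open>u\<close> into the corner; being nonzero, it can be used as a pivot.\<close>

lemma Sym_split_off:
  fixes a :: "'a :: field mat"
  assumes a: "a \<in> Sym (Suc n)" and u: "u \<in> carrier_vec (Suc n)" and nz: "u \<bullet> (a *\<^sub>v u) \<noteq> 0"
  obtains c where "c \<in> Sym n" "in_orbit (Suc n) a (bordered (u \<bullet> (a *\<^sub>v u)) (0\<^sub>v n) (0\<^sub>v n) c)"
proof -
  let ?\<alpha> = "u \<bullet> (a *\<^sub>v u)" and ?e = "unit_vec (Suc n) 0 :: 'a vec"
  note a' = Sym_carrier[OF a]
  have "a *\<^sub>v 0\<^sub>v (Suc n) = 0\<^sub>v (Suc n)" using a' by (intro eq_vecI) auto
  with nz u have "u \<noteq> 0\<^sub>v (Suc n)" by auto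
  then obtain g where g: "g \<in> carrier_mat (Suc n) (Suc n)" "invertible_mat g" "g *\<^sub>v ?e = u"
    using ex_invertible_mat_first_col[OF u] by blast
  let ?b = "transpose_mat g * a * g"
  have b: "?b \<in> Sym (Suc n)" using Sym_congruence[OF a g(1)] .
  obtain \<alpha> v c where d: "?b = bordered \<alpha> v v c" "v \<in> carrier_vec n" "c \<in> Sym n"
    using Sym_exhaust[OF b] .
  have "\<alpha> = ?b $$ (0, 0)"
    unfolding d(1) by (simp add: bordered_def)
  also have "\<dots> = ?e \<bullet> (?b *\<^sub>v ?e)"
    using Sym_carrier[OF b] by (intro unit_vec_mult_mat_vec[symmetric]) auto
  also have "?b *\<^sub>v ?e = transpose_mat g *\<^sub>v (a *\<^sub>v u)"
    using g a' by (subst mult_mat3_vec[of _ "Suc n"]) auto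
  also have "?e \<bullet> (transpose_mat g *\<^sub>v (a *\<^sub>v u)) = (transpose_mat g *\<^sub>v (a *\<^sub>v u)) \<bullet> ?e"
    using g a' u by (intro comm_scalar_prod[of _ "Suc n"]) auto
  also have "\<dots> = ?\<alpha>"
    using transpose_vec_mult_scalar[OF g(1), of ?e "a *\<^sub>v u"] a' u g
    by (simp add: comm_scalar_prod[of "a *\<^sub>v u" "Suc n" u])
  finally have \<alpha>: "\<alpha> = ?\<alpha>" .
  let ?c = "c - inverse \<alpha> \<cdot>\<^sub>m outer v v"
  have c: "?c \<in> Sym n" using d by (intro Sym_closed) auto
  have "?c + inverse \<alpha> \<cdot>\<^sub>m outer v v = c"
    using d Sym_carrier[OF d(3)] by (intro eq_matI) (auto simp: outer_def)
  then have "in_orbit (Suc n) ?b (bordered \<alpha> (0\<^sub>v n) (0\<^sub>v n) ?c)"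
    using in_orbit_schur_complement[of \<alpha> v n ?c] nz \<alpha> d c by (simp add: Sym_carrier)
  moreover have "in_orbit (Suc n) ?b a"
    using g invertible_mat_transpose[OF g(1,2)] by (auto simp: in_orbit_def intro!: bexI[of _ "transpose_mat g"])
  ultimately have "in_orbit (Suc n) a (bordered \<alpha> (0\<^sub>v n) (0\<^sub>v n) ?c)"
    using c a' by (meson Sym_carrier bordered_carrier in_orbit_sym in_orbit_trans)
  with c \<alpha> that show ?thesis by blast
qed

text \<open>Polarization: if the form vanished identically, its value at the sum of two unit vectors
  would be twice an entry of \<open>a\<close>.\<close>

lemma Sym_nonzero_value:
  fixes a :: "'a :: field mat"
  assumes two: "(2 :: 'a) \<noteq> 0" and a: "a \<in> Sym n" and nz: "a \<noteq> 0\<^sub>m n n"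
  obtains u where "u \<in> carrier_vec n" "u \<bullet> (a *\<^sub>v u) \<noteq> 0"
proof (rule ccontr)
  assume "\<not> thesis"
  with that have zero: "u \<bullet> (a *\<^sub>v u) = 0" if "u \<in> carrier_vec n" for u using that by blast
  note a' = Sym_carrier[OF a]
  have "a = 0\<^sub>m n n"
  proof (rule eq_matI)
    fix i j assume ij: "i < dim_row (0\<^sub>m n n)" "j < dim_col (0\<^sub>m n n)"
    let ?u = "unit_vec n i :: 'a vec" and ?w = "unit_vec n j :: 'a vec"
    note entry = unit_vec_mult_mat_vec[OF a']
    have "0 = (?u + ?w) \<bullet> (a *\<^sub>v (?u + ?w))" by (simp add: zero)
    also have "\<dots> = ?u \<bullet> (a *\<^sub>v ?u) + ?u \<bullet> (a *\<^sub>v ?w) + (?w \<bullet> (a *\<^sub>v ?u) + ?w \<bullet> (a *\<^sub>v ?w))"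
      by (rule quadratic_form_add[OF a']) simp_all
    also have "\<dots> = a $$ (i, j) + a $$ (j, i)"
      using zero[of ?u] zero[of ?w] entry[of i j] entry[of j i] ij by simp
    also have "a $$ (j, i) = transpose_mat a $$ (i, j)" using a' ij by simp
    also have "transpose_mat a = a" using a by (simp add: Sym_def)
    finally show "a $$ (i, j) = 0\<^sub>m n n $$ (i, j)" using two ij by (simp flip: mult_2)
  qed (use a' in auto)
  with nz show False ..
qed

text \<open>Congruent forms represent the same scalars, since the substitution by the transposed
  witness is onto.\<close>

lemma in_orbit_value:
  fixes a b :: "'a :: field mat"
  assumes "in_orbit n a b" and b: "b \<in> carrier_mat n n" and u: "u \<in> carrier_vec n"
  obtains w where "w \<in> carrier_vec n" "w \<bullet> (a *\<^sub>v w) = u \<bullet> (b *\<^sub>v u)"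
proof -
  obtain g where g: "g \<in> carrier_mat n n" "invertible_mat g" "a = g * b * transpose_mat g"
    using assms(1) by (auto simp: in_orbit_def)
  have "(\<lambda>w. transpose_mat g *\<^sub>v w) ` carrier_vec n = carrier_vec n"
    using g by (intro bij_betw_imp_surj_on bij_betw_mult_mat_vec invertible_mat_transpose) auto
  with u obtain w where w: "w \<in> carrier_vec n" "transpose_mat g *\<^sub>v w = u" by (metis image_iff)
  have "w \<bullet> (a *\<^sub>v w) = w \<bullet> (g *\<^sub>v (b *\<^sub>v u))"
    using g w b by (simp add: mult_mat3_vec[of _ n] del: assoc_mult_mat)
  also have "\<dots> = u \<bullet> (b *\<^sub>v u)"
    using transpose_vec_mult_scalar[OF g(1), of "b *\<^sub>v u" w] w b u g
    by (simp add: comm_scalar_prod[of "b *\<^sub>v u" n u])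
  finally show ?thesis using that w(1) by blast
qed

section \<open>Classification of symmetric matrices\<close>

lemma rank_mat_diag:
  "vec_space.rank n (mat_diag n f) = card {i. i < n \<and> f i \<noteq> (0 :: 'a :: {finite, field})}"
proof (induction n arbitrary: f)
  case 0
  have "mat_diag 0 f = 0\<^sub>m 0 0" by (intro eq_matI) (auto simp: mat_diag_def)
  then show ?case using rank_zero_mat[of 0] by simp
next
  case (Suc n)
  have "{i. i < Suc n \<and> f i \<noteq> 0} = (if f 0 = 0 then {} else {0}) \<union> Suc ` {i. i < n \<and> f (Suc i) \<noteq> 0}"
    (is "?L = ?R")
  proof (rule Set.set_eqI)
    fix i show "i \<in> ?L \<longleftrightarrow> i \<in> ?R" by (cases i) auto
  qed
  then have "card {i. i < Suc n \<and> f i \<noteq> 0} =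
      (if f 0 = 0 then 0 else 1) + card {i. i < n \<and> f (Suc i) \<noteq> 0}"
    by (auto simp: card_image)
  with Suc.IH[of "\<lambda>i. f (Suc i)"] show ?case
    by (simp add: mat_diag_Suc rank_bordered_diag)
qed

lemma rank_diag_one:
  assumes "r \<le> n"
  shows "vec_space.rank n (diag_one n r :: 'a :: {finite, field} mat) = r"
proof -
  have "{i. i < n \<and> (if i < r then 1 else 0) \<noteq> (0 :: 'a)} = {..<r}" using assms by auto
  then show ?thesis by (simp add: diag_one_def rank_mat_diag)
qed

lemma rank_diag_delta:
  assumes "\<delta> \<noteq> (0 :: 'a :: {finite, field})" "1 \<le> r" "r \<le> n"
  shows "vec_space.rank n (diag_delta \<delta> n r) = r"
proof -
  have "{i. i < n \<and> (if i + 1 < r then 1 else if i + 1 = r then \<delta> else 0) \<noteq> 0} = {..<r}"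
    using assms by auto
  then show ?thesis unfolding diag_delta_def rank_mat_diag by simp
qed

lemma mat_diag_Sym [simp]: "mat_diag n f \<in> Sym n"
  by (auto simp: Sym_def mat_diag_def intro!: eq_matI)

lemma diag_one_Sym [simp]: "diag_one n r \<in> Sym n"
  by (simp add: diag_one_def)

lemma diag_delta_Sym [simp]: "diag_delta \<delta> n r \<in> Sym n"
  by (simp add: diag_delta_def)

lemma diag_one_0: "diag_one n 0 = 0\<^sub>m n n"
  by (auto simp: diag_one_def mat_diag_def intro!: eq_matI)

lemma diag_one_Suc: "diag_one (Suc n) (Suc r) = bordered 1 (0\<^sub>v n) (0\<^sub>v n) (diag_one n r)"
  by (simp add: diag_one_def mat_diag_Suc)

lemma diag_delta_Suc:
  "1 \<le> r \<Longrightarrow> diag_delta \<delta> (Suc n) (Suc r) = bordered 1 (0\<^sub>v n) (0\<^sub>v n) (diag_delta \<delta> n r)"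
  by (simp add: diag_delta_def mat_diag_Suc cong: if_cong)

lemma diag_delta_1: "diag_delta \<delta> (Suc n) 1 = bordered \<delta> (0\<^sub>v n) (0\<^sub>v n) (0\<^sub>m n n)"
  by (intro eq_matI) (auto simp: diag_delta_def bordered_def mat_diag_def vec_index_vCons)

text \<open>If the form represents 1, a corner 1 splits off and induction applies. A nonzero form
  that does not represent 1 must have rank one with a non-square entry, because two nonzero diagonal
  entries already represent 1.\<close>

lemma Sym_classification:
  fixes a :: "'a :: finite_field mat"
  assumes odd: "odd CARD('a)" and \<delta>: "\<not> is_square \<delta>" and a: "a \<in> Sym n"
  shows "(\<exists>r\<le>n. in_orbit n a (diag_one n r)) \<or> (\<exists>r\<in>{1..n}. in_orbit n a (diag_delta \<delta> n r))"
  using a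
proof (induction n arbitrary: a)
  case 0
  then have "a = diag_one 0 0" by (intro eq_matI) (auto simp: Sym_def diag_one_def mat_diag_def)
  then show ?case by (metis Sym_carrier diag_one_Sym in_orbit_refl le_refl)
next
  case (Suc n)
  note two = odd_finite_field_two_nonzero[OF odd]
  consider "a = 0\<^sub>m (Suc n) (Suc n)"
    | u where "u \<in> carrier_vec (Suc n)" "u \<bullet> (a *\<^sub>v u) = 1"
    | "a \<noteq> 0\<^sub>m (Suc n) (Suc n)" "\<And>u. u \<in> carrier_vec (Suc n) \<Longrightarrow> u \<bullet> (a *\<^sub>v u) \<noteq> 1"
    by blast
  then show ?case
  proof cases
    case 1
    then show ?thesis by (metis Sym_carrier Suc.prems diag_one_0 in_orbit_refl zero_le)
  next
    case 2
    then obtain c where c: "c \<in> Sym n" "in_orbit (Suc n) a (bordered 1 (0\<^sub>v n) (0\<^sub>v n) c)"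
      using Sym_split_off[OF Suc.prems 2(1)] by auto
    have step: "in_orbit (Suc n) a (bordered 1 (0\<^sub>v n) (0\<^sub>v n) d)"
      if "in_orbit n c d" "d \<in> Sym n" for d
      using in_orbit_trans[OF c(2)] in_orbit_bordered_diag[of 1 n c d 1] that
      by (simp add: Sym_carrier)
    from Suc.IH[OF c(1)] show ?thesis
    proof (elim disjE exE bexE conjE)
      fix r assume "r \<le> n" "in_orbit n c (diag_one n r)"
      then show ?thesis using step[of "diag_one n r"] by (intro disjI1 exI[of _ "Suc r"]) (simp add: diag_one_Suc)
    next
      fix r assume "r \<in> {1..n}" "in_orbit n c (diag_delta \<delta> n r)"
      then show ?thesis using step[of "diag_delta \<delta> n r"]
        by (intro disjI2 bexI[of _ "Suc r"]) (simp_all add: diag_delta_Suc)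
    qed
  next
    case 3
    obtain u where u: "u \<in> carrier_vec (Suc n)" "u \<bullet> (a *\<^sub>v u) \<noteq> 0"
      using Sym_nonzero_value[OF two Suc.prems 3(1)] .
    define \<alpha> where "\<alpha> = u \<bullet> (a *\<^sub>v u)"
    obtain c where c: "c \<in> Sym n" "in_orbit (Suc n) a (bordered \<alpha> (0\<^sub>v n) (0\<^sub>v n) c)"
      using Sym_split_off[OF Suc.prems u] unfolding \<alpha>_def .
    have \<alpha>: "\<alpha> \<noteq> 0" using u by (simp add: \<alpha>_def)
    note c' = Sym_carrier[OF c(1)]
    \<comment> \<open>The values on the split form are values of \<open>a\<close>, hence never 1.
      The three uses below force \<open>c = 0\<close> and rule out a square
      \<open>\<alpha>\<close>.\<close>
    have no1: "\<alpha> * x\<^sup>2 + w \<bullet> (c *\<^sub>v w) \<noteq> 1" if w: "w \<in> carrier_vec n" for x w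
    proof
      assume "\<alpha> * x\<^sup>2 + w \<bullet> (c *\<^sub>v w) = 1"
      then have "vCons x w \<bullet> (bordered \<alpha> (0\<^sub>v n) (0\<^sub>v n) c *\<^sub>v vCons x w) = 1"
        using c' w by (simp add: bordered_diag_mult_vec[of _ n n] power2_eq_square mult_ac)
      with in_orbit_value[OF c(2) _, of "vCons x w"] 3(2) w c' show False
        by (metis bordered_carrier vCons_carrier_vec)
    qed
    have c0: "c = 0\<^sub>m n n"
    proof (rule ccontr)
      assume "c \<noteq> 0\<^sub>m n n"
      then obtain v where v: "v \<in> carrier_vec n" "v \<bullet> (c *\<^sub>v v) \<noteq> 0"
        using Sym_nonzero_value[OF two c(1)] by blast
      obtain x y where "\<alpha> * x\<^sup>2 + (v \<bullet> (c *\<^sub>v v)) * y\<^sup>2 = 1"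
        using diagonal_form_represents_one[OF odd \<alpha> v(2)] .
      then show False
        using no1[of "y \<cdot>\<^sub>v v" x] v c' by (simp add: mult_mat_vec[OF c'] power2_eq_square mult_ac)
    qed
    have "\<not> is_square \<alpha>"
    proof
      assume "is_square \<alpha>"
      then obtain t where "\<alpha> = t\<^sup>2" by (auto elim: is_nth_powerE)
      with \<alpha> no1[of "0\<^sub>v n" "inverse t"] c' show False by (simp add: power_inverse)
    qed
    \<comment> \<open>The quotient of two non-squares has character 1, so the corner is
      \<open>\<delta>\<close> up to a square.\<close>
    with \<delta> \<alpha> have "is_square (\<alpha> / \<delta>)"
      using quadratic_char_mult[OF odd, of "\<alpha> / \<delta>" \<delta>]
      by (auto simp: quadratic_char_def split: if_splits)
    then obtain t where "\<alpha> / \<delta> = t\<^sup>2" by (auto elim: is_nth_powerE)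
    moreover from \<delta> have "\<delta> \<noteq> 0" by auto
    ultimately have t: "\<alpha> = \<delta> * t\<^sup>2" by (simp add: field_simps)
    with \<alpha> have "t \<noteq> 0" by auto
    then have "in_orbit (Suc n) a (diag_delta \<delta> (Suc n) 1)"
      using in_orbit_trans[OF c(2)] in_orbit_bordered_diag[of t n c c \<delta>] in_orbit_refl[OF c'] c' t c0
      unfolding diag_delta_1 by simp
    then show ?thesis by (intro disjI2 bexI[of _ 1]) auto
  qed
qed

lemma smult_in_orbit:
  fixes a d :: "'a :: field mat"
  assumes "in_orbit n a d" "d \<in> carrier_mat n n"
  shows "in_orbit n (t \<cdot>\<^sub>m a) (t \<cdot>\<^sub>m d)"
proof -
  obtain g where g: "g \<in> carrier_mat n n" "invertible_mat g" "a = g * d * transpose_mat g"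
    using assms(1) by (auto simp: in_orbit_def)
  have "t \<cdot>\<^sub>m a = g * (t \<cdot>\<^sub>m d) * transpose_mat g"
    using g(1) assms(2) unfolding g(3)
    by (simp add: mult_smult_distrib[of _ n n _ n] mult_smult_assoc_mat[of _ n n _ n])
  with g show ?thesis by (auto simp: in_orbit_def)
qed

section \<open>The Gauss sum of a quadratic form\<close>

context odd_field_character
begin

text \<open>The sum \<open>W(a)\<close> of the overview, with the additive character of the
  locale.\<close>

definition form_sum :: "nat \<Rightarrow> 'a mat \<Rightarrow> complex" where
  "form_sum n a = (\<Sum>u\<in>carrier_vec n. \<psi> (u \<bullet> (a *\<^sub>v u)))"

lemma form_sum_in_orbit:
  assumes "in_orbit n a b" and b: "b \<in> carrier_mat n n"
  shows "form_sum n a = form_sum n b"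
proof -
  obtain g where g: "g \<in> carrier_mat n n" "invertible_mat g" "a = g * b * transpose_mat g"
    using assms(1) by (auto simp: in_orbit_def)
  let ?h = "\<lambda>u. transpose_mat g *\<^sub>v u"
  have "u \<bullet> (a *\<^sub>v u) = ?h u \<bullet> (b *\<^sub>v ?h u)" if u: "u \<in> carrier_vec n" for u
  proof -
    have hu: "?h u \<in> carrier_vec n" using g u by simp
    have "a *\<^sub>v u = g *\<^sub>v (b *\<^sub>v ?h u)" using g b u unfolding g(3) by (intro mult_mat3_vec[of _ n]) auto
    then show ?thesis using transpose_vec_mult_scalar[OF g(1), of "b *\<^sub>v ?h u" u] b u hu by simp
  qed
  then have "form_sum n a = (\<Sum>u\<in>carrier_vec n. \<psi> (?h u \<bullet> (b *\<^sub>v ?h u)))"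
    by (simp add: form_sum_def)
  also have "\<dots> = form_sum n b"
    unfolding form_sum_def using g
    by (intro sum.reindex_bij_betw[of ?h _ _ "\<lambda>w. \<psi> (w \<bullet> (b *\<^sub>v w))"] bij_betw_mult_mat_vec invertible_mat_transpose) auto
  finally show ?thesis .
qed

lemma form_sum_bordered_diag:
  assumes c: "c \<in> carrier_mat n n"
  shows "form_sum (Suc n) (bordered \<alpha> (0\<^sub>v n) (0\<^sub>v n) c) = qgauss \<alpha> * form_sum n c"
proof -
  have "form_sum (Suc n) (bordered \<alpha> (0\<^sub>v n) (0\<^sub>v n) c) =
      (\<Sum>x\<in>UNIV. \<Sum>w\<in>carrier_vec n. \<psi> (\<alpha> * x\<^sup>2) * \<psi> (w \<bullet> (c *\<^sub>v w)))"
    unfolding form_sum_def sum_carrier_vec_Suc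
    by (intro sum.cong refl)
      (auto simp: bordered_diag_mult_vec[OF c] psi_add[symmetric] power2_eq_square mult_ac)
  then show ?thesis by (simp add: qgauss_def form_sum_def sum_product)
qed

lemma form_sum_0_dim: "form_sum 0 a = 1"
  by (simp add: form_sum_def carrier_vec_0_eq scalar_prod_def)

lemma form_sum_mat_diag: "form_sum n (mat_diag n f) = (\<Prod>i<n. qgauss (f i))"
proof (induction n arbitrary: f)
  case (Suc n)
  show ?case
    by (simp add: mat_diag_Suc form_sum_bordered_diag Suc.IH prod.lessThan_Suc_shift del: prod.lessThan_Suc)
qed (simp add: form_sum_0_dim)

text \<open>The sum is a product over the diagonal: each nonzero entry contributes one factor
  \<open>quadratic_char t\<close>, a zero entry contributes \<open>q\<close> before and after
  scaling.\<close>

lemma form_sum_smult_mat_diag: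
  assumes "t \<noteq> 0"
  shows "form_sum n (t \<cdot>\<^sub>m mat_diag n f) =
    quadratic_char t ^ vec_space.rank n (mat_diag n f) * form_sum n (mat_diag n f)"
proof -
  have "t \<cdot>\<^sub>m mat_diag n f = mat_diag n (\<lambda>i. t * f i)" by (intro eq_matI) (auto simp: mat_diag_def)
  then have "form_sum n (t \<cdot>\<^sub>m mat_diag n f) = (\<Prod>i<n. qgauss (t * f i))"
    by (simp add: form_sum_mat_diag)
  also have "\<dots> = (\<Prod>i<n. (if f i \<noteq> 0 then quadratic_char t else 1) * qgauss (f i))"
    using assms by (intro prod.cong) (auto simp: qgauss_nonzero quadratic_char_mult[OF odd_card])
  also have "\<dots> = (\<Prod>i<n. if f i \<noteq> 0 then quadratic_char t else 1) * form_sum n (mat_diag n f)"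
    by (simp add: prod.distrib form_sum_mat_diag)
  also have "(\<Prod>i<n. if f i \<noteq> 0 then quadratic_char t else 1) =
      quadratic_char t ^ card ({..<n} \<inter> {i. f i \<noteq> 0})"
    by (subst prod.If_cases) auto
  also have "{..<n} \<inter> {i. f i \<noteq> 0} = {i. i < n \<and> f i \<noteq> 0}" by auto
  finally show ?thesis by (simp only: rank_mat_diag)
qed

lemma prod_gauss: "r \<le> n \<Longrightarrow> (\<Prod>i<n. if i < r then gauss else q) = gauss ^ r * q ^ (n - r)"
proof -
  assume "r \<le> n"
  then have "{..<n} \<inter> {i. i < r} = {..<r}" "{..<n} \<inter> - {i. i < r} = {r..<n}" by auto
  then show ?thesis by (simp add: prod.If_cases)
qed

lemma form_sum_diag_one:
  assumes "r \<le> n"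
  shows "form_sum n (diag_one n r) = q ^ (n - r) * gauss ^ r"
proof -
  have "form_sum n (diag_one n r) = (\<Prod>i<n. if i < r then gauss else q)"
    unfolding diag_one_def form_sum_mat_diag by (intro prod.cong) (auto simp: qgauss_nonzero)
  with assms show ?thesis by (simp add: prod_gauss)
qed

lemma form_sum_diag_delta:
  assumes "\<not> is_square \<delta>" "1 \<le> r" "r \<le> n"
  shows "form_sum n (diag_delta \<delta> n r) = - (q ^ (n - r) * gauss ^ r)"
proof -
  from assms(1) have \<delta>: "\<delta> \<noteq> 0" "quadratic_char \<delta> = -1" by (auto simp: quadratic_char_def)
  have "form_sum n (diag_delta \<delta> n r) =
      (\<Prod>i<n. (if i = r - 1 then -1 else 1) * (if i < r then gauss else q))"
    unfolding diag_delta_def form_sum_mat_diag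
    using \<delta> assms by (intro prod.cong) (auto simp: qgauss_nonzero)
  also have "\<dots> = - (\<Prod>i<n. if i < r then gauss else q)"
    using assms by (simp add: prod.distrib)
  finally show ?thesis using assms by (simp add: prod_gauss)
qed

end

section \<open>Rank and sign as a complete set of invariants\<close>

locale odd_field_nonsquare = odd_field_character +
  fixes \<delta> :: 'a
  assumes nonsquare: "\<not> is_square \<delta>"
begin

lemma delta_neq_0: "\<delta> \<noteq> 0"
  using nonsquare by auto

lemma Sym_cases:
  assumes "a \<in> Sym n"
  obtains r where "r \<le> n" "in_orbit n a (diag_one n r)"
    | r where "1 \<le> r" "r \<le> n" "in_orbit n a (diag_delta \<delta> n r)"
  using Sym_classification[OF odd_card nonsquare assms] by auto

abbreviation "sg \<equiv> sgn_sym \<delta>"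

lemma sgn_sym_diag_one_orbit:
  assumes "r \<le> n" "in_orbit n a (diag_one n r)"
  shows "sg n a = 1" "vec_space.rank n a = r"
  using assms rank_in_orbit[OF assms(2)] by (auto simp: sgn_sym_def rank_diag_one Sym_carrier)

text \<open>\<open>sgn_sym\<close> tests the first normal form before the second, so the value -1
  requires the two orbits to be disjoint. Equal rank is forced by \<open>rank_in_orbit\<close>; the
  Gauss sums of the two forms are then opposite and nonzero.\<close>

lemma sgn_sym_diag_delta_orbit:
  assumes "1 \<le> r" "r \<le> n" "in_orbit n a (diag_delta \<delta> n r)"
  shows "sg n a = -1" "vec_space.rank n a = r"
proof -
  show r: "vec_space.rank n a = r"
    using assms rank_in_orbit[OF assms(3)] delta_neq_0 by (simp add: rank_diag_delta Sym_carrier)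
  have "\<not> in_orbit n a (diag_one n r')" if "r' \<le> n" for r'
  proof
    assume orbit: "in_orbit n a (diag_one n r')"
    with sgn_sym_diag_one_orbit[OF that this] r have "r' = r" by simp
    with orbit assms have "form_sum n (diag_one n r) = form_sum n (diag_delta \<delta> n r)"
      by (metis form_sum_in_orbit Sym_carrier diag_one_Sym diag_delta_Sym)
    then show False
      using assms gauss_neq_0 by (simp add: form_sum_diag_one form_sum_diag_delta nonsquare)
  qed
  then show "sg n a = -1" using assms by (auto simp: sgn_sym_def)
qed

lemma
  assumes a: "a \<in> Sym n"
  shows rank_Sym_le: "vec_space.rank n a \<le> n"
    and sgn_sym_cases: "sg n a = 1 \<or> sg n a = -1"
    and form_sum_Sym: "form_sum n a = q ^ (n - vec_space.rank n a) * gauss ^ vec_space.rank n a * sg n a"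
proof -
  have "vec_space.rank n a \<le> n \<and> (sg n a = 1 \<or> sg n a = -1) \<and>
    form_sum n a = q ^ (n - vec_space.rank n a) * gauss ^ vec_space.rank n a * sg n a"
    using a
  proof (cases rule: Sym_cases)
    case (1 r)
    with form_sum_in_orbit[OF 1(2)] show ?thesis
      by (simp add: sgn_sym_diag_one_orbit form_sum_diag_one Sym_carrier)
  next
    case (2 r)
    with form_sum_in_orbit[OF 2(3)] show ?thesis
      by (simp add: sgn_sym_diag_delta_orbit form_sum_diag_delta nonsquare Sym_carrier)
  qed
  then show "vec_space.rank n a \<le> n" "sg n a = 1 \<or> sg n a = -1"
    "form_sum n a = q ^ (n - vec_space.rank n a) * gauss ^ vec_space.rank n a * sg n a"
    by auto
qed

lemma sgn_sym_square: "a \<in> Sym n \<Longrightarrow> (sg n a)\<^sup>2 = 1"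
  using sgn_sym_cases by fastforce

text \<open>All factors next to the sign are nonzero, so a sign can be read off a Gauss sum without
  exhibiting a congruence.\<close>

lemma sgn_sym_eqI:
  assumes "a \<in> Sym n" "form_sum n a = q ^ (n - vec_space.rank n a) * gauss ^ vec_space.rank n a * z"
  shows "sg n a = z"
  using form_sum_Sym[OF assms(1)] assms(2) gauss_neq_0 by simp

lemma sgn_sym_in_orbit:
  assumes "in_orbit n a b" "b \<in> Sym n"
  shows "sg n a = sg n b"
  using assms form_sum_Sym[of b n] form_sum_in_orbit[of n a b] rank_in_orbit[of n a b]
  by (intro sgn_sym_eqI) (auto simp: Sym_carrier in_orbit_Sym)

lemma sgn_sym_0: "sg n (0\<^sub>m n n) = 1"
  using sgn_sym_diag_one_orbit(1)[of 0 n "0\<^sub>m n n"] in_orbit_refl[of "0\<^sub>m n n" n] by (simp add: diag_one_0)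

text \<open>Both matrices are congruent to the same normal form. This is the reason why invariant
  quantities such as the transform depend on rank and sign only.\<close>

lemma Sym_orbit_eqI:
  assumes "a \<in> Sym n" "b \<in> Sym n" "vec_space.rank n a = vec_space.rank n b" "sg n a = sg n b"
  shows "in_orbit n a b"
proof -
  have "\<exists>d\<in>Sym n. in_orbit n a d \<and> in_orbit n b d"
    using assms(1)
  proof (cases rule: Sym_cases)
    case (1 r)
    note a = this
    show ?thesis using assms(2)
    proof (cases rule: Sym_cases)
      case (1 r')
      with a assms(3) show ?thesis by (metis diag_one_Sym sgn_sym_diag_one_orbit(2))
    next
      case (2 r')
      with a assms(4) show ?thesis by (simp add: sgn_sym_diag_one_orbit sgn_sym_diag_delta_orbit)
    qed
  next
    case (2 r)
    note a = this
    show ?thesis using assms(2)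
    proof (cases rule: Sym_cases)
      case (1 r')
      with a assms(4) show ?thesis by (simp add: sgn_sym_diag_one_orbit sgn_sym_diag_delta_orbit)
    next
      case (2 r')
      with a assms(3) show ?thesis by (metis diag_delta_Sym sgn_sym_diag_delta_orbit(2))
    qed
  qed
  then show ?thesis
    using assms by (meson Sym_carrier in_orbit_sym in_orbit_trans)
qed

text \<open>Passing to a diagonal representative reduces all three claims to scaling diagonal
  entries. The power of the character is why scaling by a non-square flips signs at odd rank
  only.\<close>

lemma
  assumes a: "a \<in> Sym n" and t: "t \<noteq> 0"
  shows rank_smult: "vec_space.rank n (t \<cdot>\<^sub>m a) = vec_space.rank n a"
    and form_sum_smult: "form_sum n (t \<cdot>\<^sub>m a) = quadratic_char t ^ vec_space.rank n a * form_sum n a"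
    and sgn_sym_smult: "sg n (t \<cdot>\<^sub>m a) = quadratic_char t ^ vec_space.rank n a * sg n a"
proof -
  have "\<exists>f. in_orbit n a (mat_diag n f)"
    using a by (cases rule: Sym_cases) (auto simp: diag_one_def diag_delta_def)
  then obtain f where f: "in_orbit n a (mat_diag n f)" ..
  have tf: "t \<cdot>\<^sub>m mat_diag n f = mat_diag n (\<lambda>i. t * f i)" by (intro eq_matI) (auto simp: mat_diag_def)
  note orbit = smult_in_orbit[OF f mat_diag_dim, of t]
  have "vec_space.rank n (t \<cdot>\<^sub>m a) = vec_space.rank n (t \<cdot>\<^sub>m mat_diag n f)"
    using rank_in_orbit[OF orbit] by simp
  also have "\<dots> = vec_space.rank n (mat_diag n f)"
    using t by (simp add: tf rank_mat_diag)
  also have "\<dots> = vec_space.rank n a" using rank_in_orbit[OF f] by simp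
  finally show r: "vec_space.rank n (t \<cdot>\<^sub>m a) = vec_space.rank n a" .
  show fs: "form_sum n (t \<cdot>\<^sub>m a) = quadratic_char t ^ vec_space.rank n a * form_sum n a"
    using form_sum_in_orbit[OF orbit] form_sum_in_orbit[OF f] rank_in_orbit[OF f]
      form_sum_smult_mat_diag[OF t, of n f] by simp
  show "sg n (t \<cdot>\<^sub>m a) = quadratic_char t ^ vec_space.rank n a * sg n a"
    using fs r form_sum_Sym[OF a] Sym_closed(3)[OF a] by (intro sgn_sym_eqI) simp_all
qed

lemma sgn_sym_bordered_diag:
  assumes "\<alpha> \<noteq> 0" and c: "c \<in> Sym n"
  shows "sg (Suc n) (bordered \<alpha> (0\<^sub>v n) (0\<^sub>v n) c) = quadratic_char \<alpha> * sg n c"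
  using assms form_sum_Sym[OF c]
  by (intro sgn_sym_eqI)
    (auto simp: rank_bordered_diag form_sum_bordered_diag Sym_carrier qgauss_nonzero)

lemma sgn_sym_bordered_zero:
  assumes c: "c \<in> Sym n"
  shows "sg (Suc n) (bordered 0 (0\<^sub>v n) (0\<^sub>v n) c) = sg n c"
  using form_sum_Sym[OF c] rank_Sym_le[OF c]
  by (intro sgn_sym_eqI)
    (auto simp: c rank_bordered_diag form_sum_bordered_diag Sym_carrier Suc_diff_le)

end

section \<open>The Fourier transform of the signed rank functions\<close>

lemma mat_trace_mult_commute:
  fixes a b :: "'a :: comm_semiring_0 mat"
  assumes "a \<in> carrier_mat m n" "b \<in> carrier_mat n m"
  shows "mat_trace (a * b) = mat_trace (b * a)"
proof -
  have "mat_trace (a * b) = (\<Sum>i<m. \<Sum>j<n. a $$ (i, j) * b $$ (j, i))"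
    using assms by (simp add: mat_trace_def scalar_prod_def atLeast0LessThan)
  also have "\<dots> = (\<Sum>j<n. \<Sum>i<m. b $$ (j, i) * a $$ (i, j))"
    by (subst sum.swap) (simp add: mult.commute)
  also have "\<dots> = mat_trace (b * a)"
    using assms by (simp add: mat_trace_def scalar_prod_def atLeast0LessThan)
  finally show ?thesis .
qed

lemma mat_trace_add:
  assumes "a \<in> carrier_mat n n" "b \<in> carrier_mat n n"
  shows "mat_trace (a + b) = mat_trace a + mat_trace b"
  using assms by (simp add: mat_trace_def sum.distrib)

lemma mat_trace_smult: "mat_trace (t \<cdot>\<^sub>m a) = (t :: 'a :: semiring_0) * mat_trace a"
  if "a \<in> carrier_mat n n"
  using that by (simp add: mat_trace_def sum_distrib_left)

lemma mat_trace_outer: "v \<in> carrier_vec n \<Longrightarrow> w \<in> carrier_vec n \<Longrightarrow> mat_trace (outer v w) = v \<bullet> w"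
  by (simp add: mat_trace_def outer_def scalar_prod_def atLeast0LessThan)

lemma mat_trace_bordered:
  assumes "c \<in> carrier_mat n n"
  shows "mat_trace (bordered \<alpha> w v c) = \<alpha> + mat_trace c"
proof -
  have "mat_trace (bordered \<alpha> w v c) = (\<Sum>i<Suc n. bordered \<alpha> w v c $$ (i, i))"
    using assms by (simp add: mat_trace_def)
  also have "\<dots> = \<alpha> + (\<Sum>i<n. c $$ (i, i))"
    using assms by (subst sum.lessThan_Suc_shift) (auto simp: bordered_def)
  finally show ?thesis using assms by (simp add: mat_trace_def)
qed

lemma mat_add_cancel:
  fixes c d :: "'a :: ab_group_add mat"
  assumes "c \<in> carrier_mat m n" "d \<in> carrier_mat m n"
  shows "c - d + d = c" "c + d - d = c"
  using assms by (auto intro!: eq_matI)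

lemma mult_outer:
  fixes b :: "'a :: comm_ring_1 mat"
  assumes b: "b \<in> carrier_mat n n" and v: "v \<in> carrier_vec n" and w: "w \<in> carrier_vec n"
  shows "b * outer v w = outer (b *\<^sub>v v) w"
proof (rule eq_matI)
  fix i j assume "i < dim_row (outer (b *\<^sub>v v) w)" "j < dim_col (outer (b *\<^sub>v v) w)"
  with assms show "(b * outer v w) $$ (i, j) = outer (b *\<^sub>v v) w $$ (i, j)"
    by (simp add: outer_def scalar_prod_def sum_distrib_right mult.assoc)
qed (use assms in \<open>auto simp: outer_def\<close>)

lemma transpose_outer: "transpose_mat (outer v w) = outer w (v :: 'a :: comm_semiring_0 vec)"
  by (intro eq_matI) (auto simp: outer_def mult.commute)

lemma outer_congruence:
  fixes g :: "'a :: comm_ring_1 mat"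
  assumes g: "g \<in> carrier_mat n n" and v: "v \<in> carrier_vec n" and w: "w \<in> carrier_vec n"
  shows "g * outer v w * transpose_mat g = outer (g *\<^sub>v v) (g *\<^sub>v w)"
proof -
  have "g * outer v w * transpose_mat g = outer (g *\<^sub>v v) w * transpose_mat g"
    using assms by (simp add: mult_outer)
  also have "\<dots> = transpose_mat (g * outer w (g *\<^sub>v v))"
    using assms by (subst transpose_mult[of _ n n _ n]) (auto simp: transpose_outer)
  also have "\<dots> = outer (g *\<^sub>v v) (g *\<^sub>v w)"
    using assms by (simp add: mult_outer transpose_outer)
  finally show ?thesis .
qed

lemma outer_unit_vec_0:
  "outer (unit_vec (Suc n) 0) (unit_vec (Suc n) 0) = bordered 1 (0\<^sub>v n) (0\<^sub>v n) (0\<^sub>m n n :: 'a :: comm_ring_1 mat)"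
  by (intro eq_matI) (auto simp: outer_def bordered_def vec_index_vCons)

text \<open>The border \<open>v\<close> drops out of the pairing with a block diagonal matrix; in
  \<open>ft_peel\<close> it therefore acts only through the Schur complement.\<close>

lemma mat_trace_bordered_diag_mult:
  fixes b c :: "'a :: comm_ring_1 mat"
  assumes b: "b \<in> carrier_mat n n" and c: "c \<in> carrier_mat n n" and v: "v \<in> carrier_vec n"
  shows "mat_trace (bordered \<beta> (0\<^sub>v n) (0\<^sub>v n) b * bordered \<alpha> v v c) = \<beta> * \<alpha> + mat_trace (b * c)"
proof -
  have "bordered \<beta> (0\<^sub>v n) (0\<^sub>v n) b * bordered \<alpha> v v c =
      bordered (\<beta> * \<alpha>) (\<beta> \<cdot>\<^sub>v v) (b *\<^sub>v v) (b * c)"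
  proof (rule eq_mat_by_mult_vec[of _ "Suc n" "Suc n"])
    fix z :: "'a vec" assume "z \<in> carrier_vec (Suc n)"
    then obtain x u where z: "z = vCons x u" "u \<in> carrier_vec n" by (rule vec_carrier_Suc_cases)
    have "(bordered \<beta> (0\<^sub>v n) (0\<^sub>v n) b * bordered \<alpha> v v c) *\<^sub>v z =
        bordered \<beta> (0\<^sub>v n) (0\<^sub>v n) b *\<^sub>v vCons (\<alpha> * x + v \<bullet> u) (x \<cdot>\<^sub>v v + c *\<^sub>v u)"
      using b c v z by (subst assoc_mult_mat_vec[of _ "Suc n" "Suc n" _ "Suc n"])
        (auto simp: bordered_mult_vec[of _ n n])
    also have "\<dots> = vCons (\<beta> * (\<alpha> * x + v \<bullet> u)) (b *\<^sub>v (x \<cdot>\<^sub>v v + c *\<^sub>v u))"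
      using b c v z by (subst bordered_diag_mult_vec[of _ n n]) auto
    also have "b *\<^sub>v (x \<cdot>\<^sub>v v + c *\<^sub>v u) = x \<cdot>\<^sub>v (b *\<^sub>v v) + (b * c) *\<^sub>v u"
      using b c v z
      by (intro eq_vecI) (auto simp: mult_add_distrib_mat_vec[of _ n n] assoc_mult_mat_vec[of _ n n _ n] scalar_prod_add_distrib[of _ n])
    also have "vCons (\<beta> * (\<alpha> * x + v \<bullet> u)) (x \<cdot>\<^sub>v (b *\<^sub>v v) + (b * c) *\<^sub>v u) =
        bordered (\<beta> * \<alpha>) (\<beta> \<cdot>\<^sub>v v) (b *\<^sub>v v) (b * c) *\<^sub>v z"
      using b c v z by (subst z(1), subst bordered_mult_vec[of _ n n]) (auto simp: algebra_simps)
    finally show "(bordered \<beta> (0\<^sub>v n) (0\<^sub>v n) b * bordered \<alpha> v v c) *\<^sub>v z =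
        bordered (\<beta> * \<alpha>) (\<beta> \<cdot>\<^sub>v v) (b *\<^sub>v v) (b * c) *\<^sub>v z" .
  qed (use b c v in auto)
  then show ?thesis by (simp add: mat_trace_bordered[OF mult_carrier_mat[OF b c]])
qed

lemma Sym_Suc_bij:
  "bij_betw (\<lambda>(\<alpha>, v, c). bordered \<alpha> v v c) (UNIV \<times> carrier_vec n \<times> Sym n) (Sym (Suc n) :: 'a :: field mat set)"
  unfolding bij_betw_def
proof (intro conjI equalityI subsetI)
  have inj: "\<alpha> = \<alpha>' \<and> v = v' \<and> c = c'"
    if "v \<in> carrier_vec n" "c \<in> Sym n" "v' \<in> carrier_vec n" "c' \<in> Sym n"
      "bordered \<alpha> v v c = bordered \<alpha>' v' v' c'" for \<alpha> \<alpha>' :: 'a and v v' and c c' :: "'a mat"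
    using that bordered_inject[of c n n v v c' v' v' \<alpha> \<alpha>'] by (simp add: Sym_carrier)
  show "inj_on (\<lambda>(\<alpha>, v, c). bordered \<alpha> v v c) (UNIV \<times> carrier_vec n \<times> (Sym n :: 'a mat set))"
  proof (rule inj_onI)
    fix p p' assume p: "p \<in> UNIV \<times> carrier_vec n \<times> (Sym n :: 'a mat set)"
      "p' \<in> UNIV \<times> carrier_vec n \<times> (Sym n :: 'a mat set)"
      "(case p of (\<alpha>, v, c) \<Rightarrow> bordered \<alpha> v v c) = (case p' of (\<alpha>, v, c) \<Rightarrow> bordered \<alpha> v v c)"
    obtain \<alpha> v c \<alpha>' v' c' where "p = (\<alpha>, v, c)" "p' = (\<alpha>', v', c')" by (metis surj_pair)
    with p inj[of v c v' c' \<alpha> \<alpha>'] show "p = p'" by simp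
  qed
next
  fix a :: "'a mat" assume "a \<in> Sym (Suc n)"
  then obtain \<alpha> v c where "a = bordered \<alpha> v v c" "v \<in> carrier_vec n" "c \<in> Sym n"
    by (rule Sym_exhaust)
  then show "a \<in> (\<lambda>(\<alpha>, v, c). bordered \<alpha> v v c) ` (UNIV \<times> carrier_vec n \<times> Sym n)" by force
qed auto

lemma finite_Sym [simp]: "finite (Sym n :: 'a :: {finite, field} mat set)"
proof (induction n)
  case 0
  have "(Sym 0 :: 'a mat set) \<subseteq> {0\<^sub>m 0 0}" by (auto simp: Sym_def intro!: eq_matI)
  then show ?case by (rule finite_subset) simp
next
  case (Suc n)
  then show ?case using bij_betw_finite[OF Sym_Suc_bij[where 'a = 'a and n = n]] by simp
qed

lemma sum_Sym_Suc:
  fixes f :: "'a :: {finite, field} mat \<Rightarrow> 'b :: comm_monoid_add"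
  shows "(\<Sum>a\<in>Sym (Suc n). f a) = (\<Sum>\<alpha>\<in>UNIV. \<Sum>v\<in>carrier_vec n. \<Sum>c\<in>Sym n. f (bordered \<alpha> v v c))"
  unfolding sum.cartesian_product
  using sum.reindex_bij_betw[OF Sym_Suc_bij, of f n] by (simp add: case_prod_unfold)

section \<open>Invariance and scaling of the transform, and the peeling step\<close>

context odd_field_nonsquare
begin

text \<open>The exponent \<open>\<sigma>\<close> treats the unsigned (0) and the signed (1) rank
  functions together; at \<open>b = 0\<close> it gives the unsigned and the signed number of
  matrices of rank \<open>r\<close>.\<close>

definition ft :: "nat \<Rightarrow> nat \<Rightarrow> nat \<Rightarrow> 'a mat \<Rightarrow> complex" where
  "ft \<sigma> n r b = (\<Sum>a\<in>Sym n. chi n r a * sg n a ^ \<sigma> * \<psi> (mat_trace (b * a)))"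

lemma chi_in_orbit:
  fixes a b :: "'a mat"
  shows "in_orbit n a b \<Longrightarrow> b \<in> Sym n \<Longrightarrow> chi n r a = chi n r b"
  using rank_in_orbit[of n a b] by (simp add: chi_def Sym_carrier)

text \<open>Cyclicity of the trace moves the congruence from \<open>b\<close> to the summation
  variable, where rank and sign do not notice it.\<close>

lemma ft_in_orbit:
  assumes "in_orbit n b d" and d: "d \<in> carrier_mat n n"
  shows "ft \<sigma> n r b = ft \<sigma> n r d"
proof -
  obtain g where g: "g \<in> carrier_mat n n" "invertible_mat g" "b = g * d * transpose_mat g"
    using assms(1) by (auto simp: in_orbit_def)
  obtain h where h: "h \<in> carrier_mat n n" "g * h = 1\<^sub>m n" "h * g = 1\<^sub>m n"
    using invertible_matE[OF g(1,2)] .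
  have t: "transpose_mat g * transpose_mat h = 1\<^sub>m n" "transpose_mat h * transpose_mat g = 1\<^sub>m n"
    using g h by (metis transpose_mult transpose_one)+
  have cancel: "transpose_mat l * (transpose_mat k * a * k) * l = a"
    if "k * l = 1\<^sub>m n" "transpose_mat l * transpose_mat k = 1\<^sub>m n" "k \<in> carrier_mat n n" "l \<in> carrier_mat n n"
      "a \<in> Sym n" for k l a :: "'a mat"
  proof -
    have "transpose_mat l * (transpose_mat k * a * k) * l = (transpose_mat l * transpose_mat k) * a * (k * l)"
      using that(3-5) by (simp add: Sym_carrier assoc_mult_mat[of _ n n _ n _ n] mult_carrier_mat[of _ n n _ n])
    also have "\<dots> = a"
      unfolding that(1,2) using Sym_carrier[OF that(5)] by simp
    finally show ?thesis .
  qed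
  show ?thesis
    unfolding ft_def
  proof (rule sum.reindex_bij_witness[of _ "\<lambda>a. transpose_mat h * a * h" "\<lambda>a. transpose_mat g * a * g"])
    fix a :: "'a mat" assume a: "a \<in> Sym n"
    show "transpose_mat h * (transpose_mat g * a * g) * h = a"
      using cancel[of g h a] g h t a by simp
    show ga: "transpose_mat g * a * g \<in> Sym n" using Sym_congruence a g by blast
    have orbit: "in_orbit n (transpose_mat g * a * g) a"
      using g invertible_mat_transpose[OF g(1,2)]
      by (auto simp: in_orbit_def intro!: bexI[of _ "transpose_mat g"])
    have "mat_trace (b * a) = mat_trace (g * (d * transpose_mat g * a))"
      using g d a by (simp add: g(3) Sym_carrier assoc_mult_mat[of _ n n _ n _ n] mult_carrier_mat[of _ n n _ n])
    also have "\<dots> = mat_trace (d * transpose_mat g * a * g)"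
      using g d a
      by (intro mat_trace_mult_commute[of _ n n]) (auto simp: Sym_carrier intro!: mult_carrier_mat[of _ n n _ n])
    also have "d * transpose_mat g * a * g = d * (transpose_mat g * a * g)"
      using g d a by (simp add: Sym_carrier assoc_mult_mat[of _ n n _ n _ n] mult_carrier_mat[of _ n n _ n])
    finally show "chi n r (transpose_mat g * a * g) * sg n (transpose_mat g * a * g) ^ \<sigma> *
        \<psi> (mat_trace (d * (transpose_mat g * a * g))) = chi n r a * sg n a ^ \<sigma> * \<psi> (mat_trace (b * a))"
      using chi_in_orbit[OF orbit a] sgn_sym_in_orbit[OF orbit a] by simp
  next
    fix a :: "'a mat" assume a: "a \<in> Sym n"
    show "transpose_mat g * (transpose_mat h * a * h) * g = a"
      using cancel[of h g a] g h t a by simp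
    show "transpose_mat h * a * h \<in> Sym n" using Sym_congruence a h by blast
  qed
qed

lemma ft_cong:
  assumes "a \<in> Sym n" "b \<in> Sym n" "vec_space.rank n a = vec_space.rank n b" "sg n a = sg n b"
  shows "ft \<sigma> n r a = ft \<sigma> n r b"
  using Sym_orbit_eqI[OF assms] ft_in_orbit assms(2) by (simp add: Sym_carrier)

lemma chi_smult:
  fixes a :: "'a mat"
  shows "a \<in> Sym n \<Longrightarrow> t \<noteq> 0 \<Longrightarrow> chi n r (t \<cdot>\<^sub>m a) = chi n r a"
  by (simp add: chi_def rank_smult)

lemma quadratic_char_power_square: "t \<noteq> 0 \<Longrightarrow> quadratic_char t ^ k * quadratic_char t ^ k = 1"
  by (metis power2_eq_square power_mult_distrib power_one quadratic_char_power2)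

text \<open>The scalar moves to the summation variable, and scaling a matrix of rank
  \<open>r\<close> multiplies its sign by \<open>quadratic_char t ^ r\<close>.\<close>

lemma ft_smult:
  assumes t: "t \<noteq> 0" and b: "b \<in> Sym n"
  shows "ft \<sigma> n r (t \<cdot>\<^sub>m b) = quadratic_char t ^ (r * \<sigma>) * ft \<sigma> n r b"
proof -
  have inv: "t \<cdot>\<^sub>m (inverse t \<cdot>\<^sub>m a) = a" "inverse t \<cdot>\<^sub>m (t \<cdot>\<^sub>m a) = a" for a :: "'a mat"
    using t by (intro eq_matI; simp add: field_simps)+
  have "ft \<sigma> n r (t \<cdot>\<^sub>m b) = (\<Sum>a\<in>Sym n. quadratic_char t ^ (r * \<sigma>) * (chi n r a * sg n a ^ \<sigma> * \<psi> (mat_trace (b * a))))"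
    unfolding ft_def
  proof (rule sum.reindex_bij_witness[of _ "\<lambda>a. inverse t \<cdot>\<^sub>m a" "\<lambda>a. t \<cdot>\<^sub>m a"])
    fix a :: "'a mat" assume a: "a \<in> Sym n"
    have "b * (t \<cdot>\<^sub>m a) = t \<cdot>\<^sub>m b * a"
      using a b by (simp add: Sym_carrier mult_smult_distrib[of _ n n _ n] mult_smult_assoc_mat[of _ n n _ n])
    moreover have "quadratic_char t ^ (r * \<sigma>) * (chi n r (t \<cdot>\<^sub>m a) * sg n (t \<cdot>\<^sub>m a) ^ \<sigma>) = chi n r a * sg n a ^ \<sigma>"
    proof (cases "vec_space.rank n a = r")
      case True
      then have "quadratic_char t ^ (r * \<sigma>) * sg n (t \<cdot>\<^sub>m a) ^ \<sigma> =
          (quadratic_char t ^ (r * \<sigma>) * quadratic_char t ^ (r * \<sigma>)) * sg n a ^ \<sigma>"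
        by (simp add: sgn_sym_smult[OF a t] power_mult_distrib power_mult)
      then show ?thesis by (simp add: chi_smult[OF a t] quadratic_char_power_square[OF t])
    qed (use a t in \<open>simp add: chi_def rank_smult\<close>)
    ultimately show "quadratic_char t ^ (r * \<sigma>) *
        (chi n r (t \<cdot>\<^sub>m a) * sg n (t \<cdot>\<^sub>m a) ^ \<sigma> * \<psi> (mat_trace (b * (t \<cdot>\<^sub>m a)))) =
        chi n r a * sg n a ^ \<sigma> * \<psi> (mat_trace (t \<cdot>\<^sub>m b * a))"
      by (simp add: mult.assoc[symmetric])
  qed (auto simp: inv Sym_closed(3))
  then show ?thesis by (simp add: ft_def sum_distrib_left)
qed

lemma quadratic_char_nonsquare: "quadratic_char \<delta> = -1"
  using nonsquare by (auto simp: quadratic_char_def)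

text \<open>Scaling by \<open>\<delta>\<close> keeps the orbit of a matrix of even rank but negates
  the transform when \<open>r\<close> is odd, so the value equals its negative.\<close>

lemma ft_odd_even:
  assumes b: "b \<in> Sym n" and "odd r" "even (vec_space.rank n b)"
  shows "ft 1 n r b = 0"
proof -
  have "ft 1 n r (\<delta> \<cdot>\<^sub>m b) = ft 1 n r b"
    using b assms(3) delta_neq_0
    by (intro ft_cong) (auto simp: rank_smult sgn_sym_smult quadratic_char_nonsquare intro: Sym_closed)
  moreover have "ft 1 n r (\<delta> \<cdot>\<^sub>m b) = - ft 1 n r b"
    using ft_smult[OF delta_neq_0 b, of 1 r] \<open>odd r\<close> by (simp add: quadratic_char_nonsquare)
  ultimately show ?thesis by simp
qed

text \<open>The sum over the nonzero corner entry in \<open>ft_peel\<close>: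
  \<open>\<psi> \<alpha> - 1\<close> is the difference of the two characters, and the power of
  \<open>quadratic_char \<alpha>\<close> collects the signs. Only the parity of \<open>k\<close>
  matters for the value.\<close>

definition peel_coeff :: "nat \<Rightarrow> complex" where
  "peel_coeff k = (\<Sum>\<alpha>\<in>UNIV - {0}. quadratic_char \<alpha> ^ k * (\<psi> \<alpha> - 1))"

lemma peel_coeff_even: "even k \<Longrightarrow> peel_coeff k = - q"
proof -
  assume "even k"
  then have "quadratic_char \<alpha> ^ k = 1" if "\<alpha> \<noteq> 0" for \<alpha> :: 'a
    using quadratic_char_power2[OF that] by (metis dvd_def power_mult power_one)
  then have "peel_coeff k = (\<Sum>\<alpha>\<in>UNIV - {0}. \<psi> \<alpha> - 1)" by (simp add: peel_coeff_def)
  also have "\<dots> = (\<Sum>\<alpha>\<in>UNIV. \<psi> \<alpha> - 1)" by (simp add: sum.remove[of UNIV 0])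
  also have "\<dots> = - q" by (simp add: sum_subtractf sum_psi q_eq)
  finally show ?thesis .
qed

lemma peel_coeff_odd: "odd k \<Longrightarrow> peel_coeff k = gauss"
proof -
  assume "odd k"
  then have "quadratic_char \<alpha> ^ k = quadratic_char \<alpha>" for \<alpha> :: 'a
    by (auto simp: quadratic_char_def intro: odd_pos)
  then have "peel_coeff k = (\<Sum>\<alpha>\<in>UNIV - {0}. quadratic_char \<alpha> * (\<psi> \<alpha> - 1))" by (simp add: peel_coeff_def)
  also have "\<dots> = (\<Sum>\<alpha>\<in>UNIV. quadratic_char \<alpha> * (\<psi> \<alpha> - 1))" by (simp add: sum.remove[of UNIV 0])
  also have "\<dots> = gauss"
    by (simp add: right_diff_distrib sum_subtractf sum_quadratic_char[OF odd_card] gauss_def)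
  finally show ?thesis .
qed

lemma quadratic_char_inverse: "quadratic_char (inverse \<alpha> :: 'a) = quadratic_char \<alpha>"
proof (cases "\<alpha> = 0")
  case False
  then have "quadratic_char \<alpha> * quadratic_char (inverse \<alpha>) = 1"
    using quadratic_char_mult[OF odd_card, of \<alpha> "inverse \<alpha>"] by simp
  then show ?thesis by (auto simp: quadratic_char_def split: if_splits)
qed simp

text \<open>Subtracting the transforms at the two bordered points kills all matrices with a vanishing
  corner entry; on the others, taking the Schur complement separates the variables.\<close>

lemma ft_peel:
  assumes b: "b \<in> Sym n"
  shows "ft \<sigma> (Suc n) (Suc r) (bordered 1 (0\<^sub>v n) (0\<^sub>v n) b) =
    ft \<sigma> (Suc n) (Suc r) (bordered 0 (0\<^sub>v n) (0\<^sub>v n) b) +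
    peel_coeff (\<sigma> + vec_space.rank n b) * form_sum n b * ft \<sigma> n r b"
proof -
  let ?B = "\<lambda>\<beta>. bordered \<beta> (0\<^sub>v n) (0\<^sub>v n) b"
  let ?w = "\<lambda>a. chi (Suc n) (Suc r) a * sg (Suc n) a ^ \<sigma>"
  note b' = Sym_carrier[OF b]
  have inner: "(\<Sum>v\<in>carrier_vec n. \<Sum>c\<in>Sym n. ?w (bordered \<alpha> v v c) * \<psi> (mat_trace (b * c))) =
      quadratic_char \<alpha> ^ (\<sigma> + vec_space.rank n b) * form_sum n b * ft \<sigma> n r b" if \<alpha>: "\<alpha> \<noteq> 0" for \<alpha>
  proof -
    have "(\<Sum>c\<in>Sym n. ?w (bordered \<alpha> v v c) * \<psi> (mat_trace (b * c))) =
        quadratic_char \<alpha> ^ \<sigma> * \<psi> (v \<bullet> ((inverse \<alpha> \<cdot>\<^sub>m b) *\<^sub>v v)) * ft \<sigma> n r b"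
      if v: "v \<in> carrier_vec n" for v
    proof -
      let ?o = "inverse \<alpha> \<cdot>\<^sub>m outer v v"
      have o: "?o \<in> Sym n" using v by (intro Sym_closed) auto
      have "(\<Sum>c\<in>Sym n. ?w (bordered \<alpha> v v c) * \<psi> (mat_trace (b * c))) =
          (\<Sum>c\<in>Sym n. ?w (bordered \<alpha> v v (c + ?o)) * \<psi> (mat_trace (b * (c + ?o))))"
      proof (rule sum.reindex_bij_witness[of _ "\<lambda>c. c + ?o" "\<lambda>c. c - ?o"])
        fix c :: "'a mat" assume c: "c \<in> Sym n"
        show "c - ?o + ?o = c" "c + ?o - ?o = c"
          using mat_add_cancel[OF Sym_carrier[OF c] Sym_carrier[OF o]] by simp_all
        then show "?w (bordered \<alpha> v v (c - ?o + ?o)) * \<psi> (mat_trace (b * (c - ?o + ?o))) =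
            ?w (bordered \<alpha> v v c) * \<psi> (mat_trace (b * c))" by simp
      qed (use o in \<open>auto intro: Sym_closed\<close>)
      also have "\<dots> = (\<Sum>c\<in>Sym n. quadratic_char \<alpha> ^ \<sigma> * \<psi> (v \<bullet> ((inverse \<alpha> \<cdot>\<^sub>m b) *\<^sub>v v)) *
          (chi n r c * sg n c ^ \<sigma> * \<psi> (mat_trace (b * c))))"
      proof (rule sum.cong[OF refl])
        fix c :: "'a mat" assume c: "c \<in> Sym n"
        note c' = Sym_carrier[OF c]
        note orbit = in_orbit_schur_complement[OF \<alpha> v c']
        have d: "bordered \<alpha> (0\<^sub>v n) (0\<^sub>v n) c \<in> Sym (Suc n)" using c by simp
        have "?w (bordered \<alpha> v v (c + ?o)) = chi n r c * (quadratic_char \<alpha> * sg n c) ^ \<sigma>"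
          unfolding chi_in_orbit[OF orbit d] sgn_sym_in_orbit[OF orbit d] sgn_sym_bordered_diag[OF \<alpha> c]
          using \<alpha> by (simp add: chi_def rank_bordered_diag[OF c'])
        moreover have "mat_trace (b * (c + ?o)) = mat_trace (b * c) + mat_trace (b * ?o)"
          using b' c' v by (subst mult_add_distrib_mat[of _ n n _ n]) (auto intro!: mat_trace_add)
        moreover have "b * ?o = inverse \<alpha> \<cdot>\<^sub>m outer (b *\<^sub>v v) v"
          using b' v by (simp add: mult_smult_distrib[of _ n n _ n] mult_outer)
        then have "mat_trace (b * ?o) = inverse \<alpha> * ((b *\<^sub>v v) \<bullet> v)"
          using b' v by (simp add: mat_trace_smult[of _ n] mat_trace_outer[of _ n])
        moreover have "v \<bullet> ((inverse \<alpha> \<cdot>\<^sub>m b) *\<^sub>v v) = inverse \<alpha> * ((b *\<^sub>v v) \<bullet> v)"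
          using b' v by (simp add: smult_mat_mult_vec[of _ n n] comm_scalar_prod[of "b *\<^sub>v v" n v])
        ultimately show "?w (bordered \<alpha> v v (c + ?o)) * \<psi> (mat_trace (b * (c + ?o))) =
            quadratic_char \<alpha> ^ \<sigma> * \<psi> (v \<bullet> ((inverse \<alpha> \<cdot>\<^sub>m b) *\<^sub>v v)) *
            (chi n r c * sg n c ^ \<sigma> * \<psi> (mat_trace (b * c)))"
          by (simp add: psi_add power_mult_distrib mult_ac)
      qed
      finally show ?thesis by (simp add: ft_def sum_distrib_left)
    qed
    then have "(\<Sum>v\<in>carrier_vec n. \<Sum>c\<in>Sym n. ?w (bordered \<alpha> v v c) * \<psi> (mat_trace (b * c))) =
        quadratic_char \<alpha> ^ \<sigma> * form_sum n (inverse \<alpha> \<cdot>\<^sub>m b) * ft \<sigma> n r b"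
      by (simp add: form_sum_def sum_distrib_left sum_distrib_right mult_ac)
    \<comment> \<open>The sum over the border is the Gauss sum of
      \<open>inverse \<alpha> \<cdot>\<^sub>m b\<close>. It yields the exponent
      \<open>vec_space.rank n b\<close>, while the corner itself contributes
      \<open>\<sigma>\<close>.\<close>
    then show ?thesis
      using \<alpha> by (simp add: form_sum_smult[OF b] quadratic_char_inverse power_add mult_ac)
  qed
  have "ft \<sigma> (Suc n) (Suc r) (?B 1) - ft \<sigma> (Suc n) (Suc r) (?B 0) =
      (\<Sum>\<alpha>\<in>UNIV. \<Sum>v\<in>carrier_vec n. \<Sum>c\<in>Sym n.
        ?w (bordered \<alpha> v v c) * \<psi> (mat_trace (?B 1 * bordered \<alpha> v v c)) -
        ?w (bordered \<alpha> v v c) * \<psi> (mat_trace (?B 0 * bordered \<alpha> v v c)))"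
    unfolding ft_def sum_Sym_Suc by (simp add: sum_subtractf)
  also have "\<dots> = (\<Sum>\<alpha>\<in>UNIV. (\<psi> \<alpha> - 1) * (\<Sum>v\<in>carrier_vec n. \<Sum>c\<in>Sym n.
        ?w (bordered \<alpha> v v c) * \<psi> (mat_trace (b * c))))"
    unfolding sum_distrib_left
    by (intro sum.cong refl)
      (simp add: mat_trace_bordered_diag_mult[OF b'] Sym_carrier psi_add algebra_simps)
  also have "\<dots> = (\<Sum>\<alpha>\<in>UNIV - {0}. (\<psi> \<alpha> - 1) * (\<Sum>v\<in>carrier_vec n. \<Sum>c\<in>Sym n.
        ?w (bordered \<alpha> v v c) * \<psi> (mat_trace (b * c))))"
    by (simp add: sum.remove[of UNIV 0])
  also have "\<dots> = peel_coeff (\<sigma> + vec_space.rank n b) * form_sum n b * ft \<sigma> n r b"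
    unfolding peel_coeff_def sum_distrib_right
    by (intro sum.cong refl) (subst inner, simp_all add: mult_ac)
  finally show ?thesis by (simp add: algebra_simps)
qed

text \<open>The witness is an invertible matrix with first column \<open>u\<close>.\<close>

lemma outer_in_orbit:
  fixes u :: "'a vec"
  assumes u: "u \<in> carrier_vec (Suc n)" "u \<noteq> 0\<^sub>v (Suc n)"
  shows "in_orbit (Suc n) (outer u u) (bordered 1 (0\<^sub>v n) (0\<^sub>v n) (0\<^sub>m n n))"
proof -
  obtain g where g: "g \<in> carrier_mat (Suc n) (Suc n)" "invertible_mat g" "g *\<^sub>v unit_vec (Suc n) 0 = u"
    using ex_invertible_mat_first_col[OF u] .
  then show ?thesis
    using outer_congruence[OF g(1), of "unit_vec (Suc n) 0" "unit_vec (Suc n) 0"]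
    unfolding in_orbit_def outer_unit_vec_0[symmetric] by (intro bexI[of _ g]) simp_all
qed

text \<open>After exchanging the sums, the pairing with \<open>outer u u\<close> is the value of the
  form at \<open>u\<close>, so the inner sum is \<open>form_sum n a\<close>. Its factor
  \<open>sg n a\<close> raises \<open>\<sigma>\<close> by one.\<close>

lemma sum_ft_outer:
  assumes "r \<le> n"
  shows "(\<Sum>u\<in>carrier_vec n. ft \<sigma> n r (outer u u)) = q ^ (n - r) * gauss ^ r * ft (Suc \<sigma>) n r (0\<^sub>m n n)"
proof -
  have "(\<Sum>u\<in>carrier_vec n. ft \<sigma> n r (outer u u)) =
      (\<Sum>a\<in>Sym n. chi n r a * sg n a ^ \<sigma> * (\<Sum>u\<in>carrier_vec n. \<psi> (mat_trace (outer u u * a))))"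
    unfolding ft_def sum_distrib_left by (rule sum.swap)
  also have "\<dots> = (\<Sum>a\<in>Sym n. chi n r a * sg n a ^ \<sigma> * form_sum n a)"
  proof (intro sum.cong refl arg_cong2[of _ _ _ _ "(*)"])
    fix a :: "'a mat" assume "a \<in> Sym n"
    then have a: "a \<in> carrier_mat n n" by (rule Sym_carrier)
    have "mat_trace (outer u u * a) = u \<bullet> (a *\<^sub>v u)" if u: "u \<in> carrier_vec n" for u
    proof -
      have "mat_trace (outer u u * a) = mat_trace (a * outer u u)"
        using a u by (intro mat_trace_mult_commute) auto
      also have "\<dots> = u \<bullet> (a *\<^sub>v u)"
        using a u by (simp add: mult_outer mat_trace_outer[of _ n] comm_scalar_prod[of "a *\<^sub>v u" n u])
      finally show ?thesis .
    qed
    then show "(\<Sum>u\<in>carrier_vec n. \<psi> (mat_trace (outer u u * a))) = form_sum n a"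
      by (simp add: form_sum_def)
  qed
  also have "\<dots> = (\<Sum>a\<in>Sym n. q ^ (n - r) * gauss ^ r * (chi n r a * sg n a ^ Suc \<sigma>))"
    by (intro sum.cong) (auto simp: chi_def form_sum_Sym)
  also have "\<dots> = q ^ (n - r) * gauss ^ r * ft (Suc \<sigma>) n r (0\<^sub>m n n)"
    unfolding ft_def sum_distrib_left
    by (intro sum.cong refl) (auto simp: mat_trace_def Sym_def)
  finally show ?thesis .
qed

text \<open>Two evaluations of the sum over all \<open>outer u u\<close>: \<open>u = 0\<close> gives
  the value at 0, and the remaining \<open>q ^ Suc n - 1\<close> vectors give equal values at a
  rank-one point, which one peeling step reduces to values at 0.\<close>

lemma ft_zero_recurrence:
  assumes "r \<le> n"
  shows "q ^ Suc n * ft \<sigma> (Suc n) (Suc r) (0\<^sub>m (Suc n) (Suc n)) +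
      (q ^ Suc n - 1) * (peel_coeff \<sigma> * q ^ n * ft \<sigma> n r (0\<^sub>m n n)) =
    q ^ (n - r) * gauss ^ Suc r * ft (Suc \<sigma>) (Suc n) (Suc r) (0\<^sub>m (Suc n) (Suc n))"
proof -
  let ?N = "Suc n" and ?R = "Suc r" and ?E = "bordered 1 (0\<^sub>v n) (0\<^sub>v n) (0\<^sub>m n n) :: 'a mat"
  have zero: "(0\<^sub>m n n :: 'a mat) \<in> Sym n" "bordered 0 (0\<^sub>v n) (0\<^sub>v n) (0\<^sub>m n n) = (0\<^sub>m ?N ?N :: 'a mat)"
    by (auto simp: Sym_def bordered_def vec_index_vCons intro!: eq_matI)
  have "form_sum n (0\<^sub>m n n) = q ^ n"
    using form_sum_diag_one[of 0 n] by (simp add: diag_one_0)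
  then have E: "ft \<sigma> ?N ?R ?E = ft \<sigma> ?N ?R (0\<^sub>m ?N ?N) + peel_coeff \<sigma> * q ^ n * ft \<sigma> n r (0\<^sub>m n n)"
    using ft_peel[OF zero(1), of \<sigma> r] by (simp add: zero(2) rank_zero_mat)
  have "q ^ (?N - ?R) * gauss ^ ?R * ft (Suc \<sigma>) ?N ?R (0\<^sub>m ?N ?N) =
      (\<Sum>u\<in>carrier_vec ?N. ft \<sigma> ?N ?R (outer u u))"
    using sum_ft_outer[of ?R ?N] assms by simp
  also have "\<dots> = ft \<sigma> ?N ?R (outer (0\<^sub>v ?N) (0\<^sub>v ?N)) +
      (\<Sum>u\<in>carrier_vec ?N - {0\<^sub>v ?N}. ft \<sigma> ?N ?R (outer u u))"
    by (intro sum.remove) auto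
  also have "outer (0\<^sub>v ?N) (0\<^sub>v ?N) = (0\<^sub>m ?N ?N :: 'a mat)"
    by (intro eq_matI) (auto simp: outer_def)
  also have "(\<Sum>u\<in>carrier_vec ?N - {0\<^sub>v ?N}. ft \<sigma> ?N ?R (outer u u)) =
      (\<Sum>u\<in>carrier_vec ?N - {0\<^sub>v ?N :: 'a vec}. ft \<sigma> ?N ?R ?E)"
    by (intro sum.cong refl ft_in_orbit outer_in_orbit) auto
  also have "\<dots> = (q ^ ?N - 1) * ft \<sigma> ?N ?R ?E"
    by (simp add: card_Diff_singleton card_carrier_vec q_eq of_nat_diff)
  finally show ?thesis by (simp add: E algebra_simps)
qed

end

section \<open>The recurrence at even ranks and its boundary values\<close>

locale odd_field_transform = odd_field_nonsquare +
  fixes eps :: complex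
  assumes eps_eq: "eps = (if CARD('a) mod 4 = 1 then 1 else -1)"
begin

lemma eps_square: "eps * eps = 1"
  by (simp add: eps_eq)

text \<open>The function \<open>H(m,x,y)\<close> of the overview is
  \<open>ev m (2 * x) (2 * y)\<close>. Points of sign 1 suffice: for odd \<open>r\<close> and odd
  \<open>s\<close> the value at the other orbit of rank \<open>s\<close> is the negative.\<close>

definition ev :: "nat \<Rightarrow> nat \<Rightarrow> nat \<Rightarrow> complex" where
  "ev n r s = ft 1 n r (diag_one n s)"

lemma sgn_sym_diag_one: "s \<le> n \<Longrightarrow> sg n (diag_one n s) = 1"
  by (simp add: sgn_sym_diag_one_orbit(1) in_orbit_refl Sym_carrier)

lemma ev_peel:
  assumes "s \<le> n"
  shows "ev (Suc n) (Suc r) (Suc s) =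
    ev (Suc n) (Suc r) s + peel_coeff (Suc s) * (q ^ (n - s) * gauss ^ s) * ev n r s"
proof -
  have "ft 1 (Suc n) (Suc r) (bordered 0 (0\<^sub>v n) (0\<^sub>v n) (diag_one n s)) = ev (Suc n) (Suc r) s"
    unfolding ev_def using assms
    by (intro ft_cong) (simp_all add: rank_bordered_diag rank_diag_one Sym_carrier sgn_sym_bordered_zero sgn_sym_diag_one)
  then show ?thesis
    using ft_peel[OF diag_one_Sym, of 1 n r s] assms
    by (simp add: ev_def diag_one_Suc rank_diag_one form_sum_diag_one)
qed

lemma ev_odd_even: "odd r \<Longrightarrow> even s \<Longrightarrow> s \<le> n \<Longrightarrow> ev n r s = 0"
  unfolding ev_def by (intro ft_odd_even) (simp_all add: rank_diag_one)

lemma rank_0_Sym: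
  assumes "a \<in> Sym n" "vec_space.rank n a = 0"
  shows "a = (0\<^sub>m n n :: 'a mat)"
  using assms(1)
proof (cases rule: Sym_cases)
  case (1 r)
  with assms have "r = 0" using sgn_sym_diag_one_orbit(2) by simp
  with 1 obtain g where "g \<in> carrier_mat n n" "a = g * 0\<^sub>m n n * transpose_mat g"
    by (auto simp: in_orbit_def diag_one_0)
  then show ?thesis by simp
next
  case (2 r)
  with assms show ?thesis using sgn_sym_diag_delta_orbit(2) by simp
qed

lemma ft_rank_0:
  assumes b: "b \<in> Sym n"
  shows "ft \<sigma> n 0 b = 1"
proof -
  have zero: "(0\<^sub>m n n :: 'a mat) \<in> Sym n" by (auto simp: Sym_def)
  have "ft \<sigma> n 0 b = (\<Sum>a\<in>(Sym n :: 'a mat set). if a = 0\<^sub>m n n then 1 else 0)"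
    unfolding ft_def
  proof (rule sum.cong[OF refl])
    fix a :: "'a mat" assume a: "a \<in> Sym n"
    have "mat_trace (b * 0\<^sub>m n n) = 0" using Sym_carrier[OF b] by (simp add: mat_trace_def)
    moreover have "chi n 0 a = (if a = 0\<^sub>m n n then 1 else 0)"
      unfolding chi_def using rank_0_Sym[OF a] rank_zero_mat by metis
    ultimately show "chi n 0 a * sg n a ^ \<sigma> * \<psi> (mat_trace (b * a)) = (if a = 0\<^sub>m n n then 1 else 0)"
      by (simp add: sgn_sym_0)
  qed
  with zero show ?thesis by simp
qed

lemma gauss_power_even: "gauss ^ (2 * k) = eps ^ k * q ^ k"
  by (simp add: power_mult gauss_square quadratic_char_minus_1[OF odd_card] eps_eq power_mult_distrib)

text \<open>The new term is built from two Gauss terms, one for each peel, and their powers combine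
  to \<open>gauss ^ (4 * y + 2)\<close>; since this exponent is twice an odd number, a single
  \<open>eps\<close> survives.\<close>

lemma ev_step:
  assumes "2 * y \<le> m"
  shows "ev (Suc (Suc m)) (2 * Suc x) (2 * Suc y) =
    ev (Suc (Suc m)) (2 * Suc x) (2 * y) - eps * q ^ (2 * m + 2 - 2 * y) * ev m (2 * x) (2 * y)"
proof -
  obtain d where d: "m = 2 * y + d" using assms le_Suc_ex by blast
  \<comment> \<open>Odd \<open>r\<close>: the old value sits at even rank and vanishes, so only the
    Gauss term remains.\<close>
  have 1: "ev (Suc m) (Suc (2 * x)) (Suc (2 * y)) = gauss * (q ^ d * gauss ^ (2 * y)) * ev m (2 * x) (2 * y)"
    using ev_peel[of "2 * y" m "2 * x"] ev_odd_even[of "Suc (2 * x)" "2 * y" "Suc m"]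
    by (simp add: d peel_coeff_odd)
  \<comment> \<open>Even \<open>r\<close>: here the Gauss term carries a factor with odd
    \<open>r\<close> at even rank and vanishes.\<close>
  have 2: "ev (Suc (Suc m)) (Suc (Suc (2 * x))) (Suc (2 * y)) = ev (Suc (Suc m)) (Suc (Suc (2 * x))) (2 * y)"
    using ev_peel[of "2 * y" "Suc m" "Suc (2 * x)"] ev_odd_even[of "Suc (2 * x)" "2 * y" "Suc m"]
    by (simp add: d)
  have "2 * (2 * y + 1) = Suc (2 * y) + Suc (2 * y)" by simp
  then have g: "gauss ^ (2 * (2 * y + 1)) = gauss ^ Suc (2 * y) * (gauss * gauss ^ (2 * y))"
    by (simp only: power_add power_Suc)
  have "ev (Suc (Suc m)) (Suc (Suc (2 * x))) (Suc (Suc (2 * y))) =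
      ev (Suc (Suc m)) (Suc (Suc (2 * x))) (2 * y) -
      q * (q ^ d * gauss ^ Suc (2 * y)) * (gauss * (q ^ d * gauss ^ (2 * y)) * ev m (2 * x) (2 * y))"
    using ev_peel[of "Suc (2 * y)" "Suc m" "Suc (2 * x)"]
    by (simp add: d 1[unfolded d] 2[unfolded d] peel_coeff_even)
  also have "q * (q ^ d * gauss ^ Suc (2 * y)) * (gauss * (q ^ d * gauss ^ (2 * y)) * ev m (2 * x) (2 * y)) =
      q * q ^ d * q ^ d * gauss ^ (2 * (2 * y + 1)) * ev m (2 * x) (2 * y)"
    unfolding g by (simp only: mult_ac)
  also have "gauss ^ (2 * (2 * y + 1)) = eps * q ^ (2 * y + 1)"
    unfolding gauss_power_even by (simp add: power_mult power2_eq_square eps_square)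
  also have "q * q ^ d * q ^ d * (eps * q ^ (2 * y + 1)) = eps * q ^ (2 * m + 2 - 2 * y)"
  proof -
    have "q ^ (2 * m + 2 - 2 * y) = q ^ (Suc d + d + (2 * y + 1))"
      by (rule arg_cong[of _ _ "power q"]) (simp add: d)
    then show ?thesis by (simp only: power_add power_Suc mult_ac)
  qed
  finally show ?thesis by simp
qed

lemma ft_zero_odd:
  assumes "odd r"
  shows "ft 1 n r (0\<^sub>m n n) = 0"
  using ev_odd_even[OF assms, of 0 n] by (simp add: ev_def diag_one_0)

text \<open>Signs square to 1. Hence the relation that raises \<open>\<sigma>\<close> by one
  connects just two families of counts.\<close>

lemma ft_parity: "ft (Suc (Suc \<sigma>)) n r b = ft \<sigma> n r b"
proof -
  have *: "sg n a ^ Suc (Suc \<sigma>) = sg n a ^ \<sigma>" if "a \<in> Sym n" for a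
    using sgn_sym_square[OF that] by (simp add: power2_eq_square)
  show ?thesis unfolding ft_def by (intro sum.cong refl) (simp only: *)
qed

text \<open>In the relation for \<open>\<sigma> = 1\<close> the term from the smaller size is a
  signed count at odd rank, which is zero; what remains compares the two counts at the same size and
  rank.\<close>

lemma signed_count_even_rank:
  assumes "2 * x \<le> m"
  shows "ft 0 m (2 * x) (0\<^sub>m m m) = eps ^ x * q ^ x * ft 1 m (2 * x) (0\<^sub>m m m)"
proof (cases x)
  case 0
  have "(0\<^sub>m m m :: 'a mat) \<in> Sym m" by (auto simp: Sym_def)
  then show ?thesis by (simp add: 0 ft_rank_0)
next
  case (Suc z)
  with assms obtain d where d: "m = Suc (Suc (2 * z + d))"
    using le_Suc_ex by (metis add_Suc mult_Suc_right numeral_2_eq_2 plus_1_eq_Suc add_2_eq_Suc)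
  have "q ^ m * ft 1 m (2 * x) (0\<^sub>m m m) = q ^ d * gauss ^ (2 * x) * ft 0 m (2 * x) (0\<^sub>m m m)"
    using ft_zero_recurrence[of "Suc (2 * z)" "Suc (2 * z + d)" 1] ft_zero_odd[of "Suc (2 * z)"]
    by (simp add: d Suc ft_parity)
  also have "q ^ m = q ^ d * q ^ x * q ^ x"
    unfolding d Suc power_add[symmetric] by (rule arg_cong[of _ _ "power q"]) simp
  finally have "q ^ x * ft 1 m (2 * x) (0\<^sub>m m m) = eps ^ x * ft 0 m (2 * x) (0\<^sub>m m m)"
    by (simp add: gauss_power_even)
  moreover have "eps ^ x * eps ^ x = 1" by (simp flip: power_mult_distrib add: eps_square)
  ultimately show ?thesis
    by (metis mult.assoc mult.left_commute mult_1)
qed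

text \<open>Unsigned counts climb from rank \<open>2 * x\<close> to \<open>2 * x + 2\<close> through
  rank \<open>2 * x + 1\<close>. At each even rank \<open>signed_count_even_rank\<close> replaces
  the unsigned count by the signed one, leaving a relation among signed counts alone.\<close>

lemma signed_count_step:
  assumes "2 * x \<le> m"
  shows "(q ^ (2 * x + 2) - 1) * ev (Suc (Suc m)) (2 * Suc x) 0 =
    eps * q ^ (2 * x + 1) * (q ^ (m + 2) - 1) * (q ^ (m + 1) - 1) * ev m (2 * x) 0"
proof -
  let ?C = "\<lambda>n r. ft 0 n r (0\<^sub>m n n)" and ?T = "\<lambda>n r. ft 1 n r (0\<^sub>m n n)"
  obtain d where d: "m = 2 * x + d" using assms le_Suc_ex by blast
  \<comment> \<open>The right-hand side of the relation for \<open>\<sigma> = 0\<close> is a signed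
    count at odd rank and vanishes.\<close>
  have "q ^ Suc m * ?C (Suc m) (Suc (2 * x)) = q ^ Suc m * ((q ^ Suc m - 1) * ?C m (2 * x))"
    using ft_zero_recurrence[of "2 * x" m 0] ft_zero_odd[of "Suc (2 * x)" "Suc m"] assms
    by (simp add: peel_coeff_even algebra_simps)
  then have odd: "?C (Suc m) (Suc (2 * x)) = (q ^ Suc m - 1) * ?C m (2 * x)"
    by (subst (asm) mult_left_cancel) simp_all
  have C: "?C m (2 * x) = eps ^ x * q ^ x * ?T m (2 * x)"
    by (rule signed_count_even_rank[OF assms])
  have C': "?C (Suc (Suc m)) (2 * Suc x) = eps ^ Suc x * q ^ Suc x * ?T (Suc (Suc m)) (2 * Suc x)"
    using assms by (intro signed_count_even_rank) simp
  let ?t = "?T (Suc (Suc m)) (2 * Suc x)"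
  have "q ^ Suc (Suc m) * ?C (Suc (Suc m)) (2 * Suc x) -
      (q ^ Suc (Suc m) - 1) * (q ^ Suc (Suc m) * ?C (Suc m) (Suc (2 * x))) =
      q ^ d * gauss ^ (2 * Suc x) * ?t"
    using ft_zero_recurrence[of "Suc (2 * x)" "Suc m" 0]
    by (simp add: d peel_coeff_even)
  moreover have "q ^ Suc (Suc m) = q ^ d * q ^ (2 * x + 2)" by (simp add: d power_add mult_ac)
  ultimately have "q ^ d * (q ^ (2 * x + 2) * ?C (Suc (Suc m)) (2 * Suc x)) =
      q ^ d * ((q ^ (m + 2) - 1) * q ^ (2 * x + 2) * ?C (Suc m) (Suc (2 * x)) + gauss ^ (2 * Suc x) * ?t)"
    by (simp add: algebra_simps)
  then have "q ^ (2 * x + 2) * ?C (Suc (Suc m)) (2 * Suc x) =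
      (q ^ (m + 2) - 1) * q ^ (2 * x + 2) * ?C (Suc m) (Suc (2 * x)) + gauss ^ (2 * Suc x) * ?t"
    by (subst (asm) mult_left_cancel) simp_all
  then have "eps ^ x * q ^ Suc x * (eps * ((q ^ (2 * x + 2) - 1) * ?t)) =
      eps ^ x * q ^ Suc x * (q ^ (2 * x + 1) * (q ^ (m + 2) - 1) * (q ^ (m + 1) - 1) * ?T m (2 * x))"
    unfolding C' odd C gauss_power_even by (simp add: algebra_simps)
  moreover have "eps ^ x * q ^ Suc x \<noteq> 0" using eps_square by auto
  ultimately have "eps * ((q ^ (2 * x + 2) - 1) * ?t) =
      q ^ (2 * x + 1) * (q ^ (m + 2) - 1) * (q ^ (m + 1) - 1) * ?T m (2 * x)"
    by (metis mult_left_cancel)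
  then have "eps * eps * ((q ^ (2 * x + 2) - 1) * ?t) =
      eps * (q ^ (2 * x + 1) * (q ^ (m + 2) - 1) * (q ^ (m + 1) - 1) * ?T m (2 * x))"
    by simp
  then show ?thesis by (simp add: eps_square ev_def diag_one_0 mult.assoc)
qed

end

section \<open>Affine q-Krawtchouk polynomials\<close>

lemma qpoch_Suc_left: "qpoch a q (Suc k) = (1 - a) * qpoch (a * q) q k"
  by (simp add: qpoch_def prod.lessThan_Suc_shift mult_ac del: prod.lessThan_Suc)

lemma qpoch_Suc: "qpoch a q (Suc k) = qpoch a q k * (1 - a * q ^ k)"
  by (simp add: qpoch_def)

text \<open>The factor with index \<open>y\<close> is zero. This lets sums over
  \<open>k \<le> y\<close> be extended, and reduces the case \<open>x = 0\<close> to the term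
  \<open>k = 0\<close>.\<close>

lemma qpoch_inverse_power_eq_0:
  assumes "(q :: 'b :: field) \<noteq> 0" "y < k"
  shows "qpoch (q powi (- int y)) q k = 0"
proof -
  have "1 - q powi (- int y) * q ^ y = 0" using assms(1) by (simp add: power_int_minus)
  with assms(2) show ?thesis unfolding qpoch_def by (intro prod_zero) auto
qed

text \<open>The two factors \<open>(q ^ (2 * N \<plusminus> 1); q ^ (-2))\<close> and \<open>(q ^ (2 * N); q ^ (-2))\<close> of the
  claim interlace to this product, whatever the parity of the matrix size.\<close>

definition falling :: "'b :: field \<Rightarrow> nat \<Rightarrow> nat \<Rightarrow> 'b" where
  "falling q m k = (\<Prod>i<2 * k. 1 - q ^ (m - i))"

lemma falling_0 [simp]: "falling q m 0 = 1"
  by (simp add: falling_def)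

lemma falling_Suc: "falling q m (Suc k) = falling q m k * ((1 - q ^ (m - 2 * k)) * (1 - q ^ (m - 2 * k - 1)))"
  by (simp add: falling_def mult.assoc)

lemma falling_Suc_Suc: "falling q (Suc (Suc m)) (Suc k) = (1 - q ^ (m + 2)) * (1 - q ^ (m + 1)) * falling q m k"
  unfolding falling_def by (simp add: prod.lessThan_Suc_shift del: prod.lessThan_Suc)

text \<open>The part of the \<open>k\<close>-th term that does not involve \<open>y\<close>,
  including the prefactor that depends on \<open>x\<close>. With it split off, a difference in
  \<open>y\<close> acts on one q-Pochhammer symbol only.\<close>

definition kernel_coeff :: "'b :: field \<Rightarrow> 'b \<Rightarrow> nat \<Rightarrow> nat \<Rightarrow> nat \<Rightarrow> 'b" where
  "kernel_coeff e q m x k = (- e) ^ x * q ^ (x\<^sup>2) * falling q m x / qpoch (q\<^sup>2) (q\<^sup>2) x *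
     (qpoch ((q\<^sup>2) powi (- int x)) (q\<^sup>2) k * (q\<^sup>2) ^ k) / (falling (inverse q) m k * qpoch (q\<^sup>2) (q\<^sup>2) k)"

text \<open>The closed form for \<open>H(m,x,y)\<close>: the affine q-Krawtchouk polynomial times
  its prefactor, with both bases written through \<open>falling\<close> so that the parity of
  \<open>m\<close> does not enter.\<close>

definition krawtchouk_kernel :: "'b :: field \<Rightarrow> 'b \<Rightarrow> nat \<Rightarrow> nat \<Rightarrow> nat \<Rightarrow> 'b" where
  "krawtchouk_kernel e q m x y = (\<Sum>k\<le>y. kernel_coeff e q m x k * qpoch ((q\<^sup>2) powi (- int y)) (q\<^sup>2) k)"

text \<open>The identities below are rational identities in \<open>q\<close>; the hypotheses keep
  their denominators away from zero.\<close>

locale not_root_of_unity =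
  fixes q :: "'b :: field"
  assumes nonzero: "q \<noteq> 0" and power_neq_1: "\<And>k. k > 0 \<Longrightarrow> q ^ k \<noteq> 1"
begin

lemma qpoch_neq_0: "qpoch (q\<^sup>2) (q\<^sup>2) k \<noteq> 0"
proof -
  have "q\<^sup>2 * (q\<^sup>2) ^ i \<noteq> 1" for i using power_neq_1[of "2 * Suc i", unfolded power_mult] by simp
  then show ?thesis by (auto simp: qpoch_def)
qed

lemma falling_inverse_neq_0: "2 * k \<le> m \<Longrightarrow> falling (inverse q) m k \<noteq> 0"
  using power_neq_1 by (auto simp: falling_def power_inverse)

lemma sq_power: "(q\<^sup>2) ^ k = q ^ (2 * k)"
  by (simp only: power_mult)

lemma sq_powi: "(q\<^sup>2) powi (- int k) = inverse (q ^ (2 * k))"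
  by (simp only: power_int_minus power_int_of_nat power_mult)

text \<open>Each symbol gains or loses one factor. The quotients
  \<open>(1 - a) / (1 - inverse a) = - a\<close> for \<open>a = q ^ (m + 2)\<close> and
  \<open>a = q ^ (m + 1)\<close> produce \<open>q ^ (2 * m + 3)\<close>, and one more
  \<open>q\<close> comes from the remaining factors. The factor
  \<open>1 - (q\<^sup>2) ^ Suc k\<close> is left on the left because \<open>qpoch_difference\<close>
  supplies it.\<close>

lemma kernel_coeff_step:
  assumes "2 * k \<le> m"
  shows "kernel_coeff e q (Suc (Suc m)) (Suc x) (Suc k) * (1 - (q\<^sup>2) ^ Suc k) =
    e * q ^ (2 * m + 4) * kernel_coeff e q m x k"
proof -
  define X where "X = q ^ (2 * x + 2)"
  define Z where "Z = (q\<^sup>2) ^ Suc k"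
  define F where "F = falling (inverse q) m k"
  define G where "G = qpoch (q\<^sup>2) (q\<^sup>2) x"
  define H where "H = qpoch (q\<^sup>2) (q\<^sup>2) k"
  define U where "U = qpoch ((q\<^sup>2) powi (- int x)) (q\<^sup>2) k"
  define a where "a = q ^ (m + 2)"
  define b where "b = q ^ (m + 1)"
  have X: "X \<noteq> 0" "1 - X \<noteq> 0" using nonzero power_neq_1[of "2 * x + 2"] by (auto simp: X_def)
  have Z: "1 - Z \<noteq> 0" using power_neq_1[of "2 * Suc k", unfolded power_mult] by (simp add: Z_def)
  have ab: "a \<noteq> 0" "b \<noteq> 0" "a - 1 \<noteq> 0" "b - 1 \<noteq> 0" "1 - a \<noteq> 0" "1 - b \<noteq> 0"
    using nonzero power_neq_1[of "m + 2"] power_neq_1[of "m + 1"] by (auto simp: a_def b_def)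
  have nz: "F \<noteq> 0" "G \<noteq> 0" "H \<noteq> 0"
    using assms falling_inverse_neq_0 qpoch_neq_0 by (auto simp: F_def G_def H_def)
  have U': "qpoch ((q\<^sup>2) powi (- int (Suc x))) (q\<^sup>2) (Suc k) = (1 - inverse X) * U"
  proof -
    have "(q\<^sup>2) powi (- int (Suc x)) = inverse X"
      using sq_powi[of "Suc x"] by (simp add: X_def add.commute)
    moreover have "(q\<^sup>2) powi (- int (Suc x)) * q\<^sup>2 = (q\<^sup>2) powi (- int x)"
      using power_int_add_1[of "q\<^sup>2" "- int (Suc x)"] nonzero by simp
    ultimately show ?thesis by (simp add: qpoch_Suc_left U_def)
  qed
  have G': "qpoch (q\<^sup>2) (q\<^sup>2) (Suc x) = G * (1 - X)"
    using sq_power[of "Suc x"] by (simp add: qpoch_Suc G_def X_def)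
  have H': "qpoch (q\<^sup>2) (q\<^sup>2) (Suc k) = H * (1 - Z)"
    by (simp add: qpoch_Suc H_def Z_def)
  have F': "falling (inverse q) (Suc (Suc m)) (Suc k) = (1 - inverse a) * (1 - inverse b) * F"
    unfolding falling_Suc_Suc F_def a_def b_def by (simp only: power_inverse)
  have P': "falling q (Suc (Suc m)) (Suc x) = (1 - a) * (1 - b) * falling q m x"
    unfolding falling_Suc_Suc a_def b_def ..
  have sq: "q ^ ((Suc x)\<^sup>2) = q ^ (x\<^sup>2) * (X / q)"
  proof -
    have "(Suc x)\<^sup>2 = x\<^sup>2 + (2 * x + 1)" by (simp add: power2_eq_square)
    then show ?thesis using nonzero by (simp add: X_def power_add)
  qed
  have ab': "q ^ (2 * m + 4) = q * (a * b)"
    by (simp add: a_def b_def power_add mult_2 power2_eq_square numeral_eq_Suc mult_ac)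
  have Qk: "(q\<^sup>2) ^ Suc k = q\<^sup>2 * (q\<^sup>2) ^ k" by simp
  have inv: "1 - inverse a = - ((1 - a) / a)" "1 - inverse b = - ((1 - b) / b)" "1 - inverse X = - ((1 - X) / X)"
    using ab X by (simp_all add: field_simps)
  define V where "V = (- e) ^ x * q ^ (x\<^sup>2) * falling q m x * U * (q\<^sup>2) ^ k"
  have "kernel_coeff e q (Suc (Suc m)) (Suc x) (Suc k) * (1 - (q\<^sup>2) ^ Suc k) =
      (- e) * V * (X / q) * ((1 - a) * (1 - b)) * (1 - inverse X) * q\<^sup>2 * (1 - Z) /
      (G * (1 - X) * ((1 - inverse a) * (1 - inverse b) * F) * (H * (1 - Z)))"
    unfolding kernel_coeff_def U' G' H' F' P' sq V_def Z_def Qk by (simp add: mult_ac)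
  also have "\<dots> = e * (q * (a * b)) * (V / (G * F * H))"
    unfolding inv using ab X Z nz nonzero by (simp add: divide_simps power2_eq_square)
  also have "\<dots> = e * q ^ (2 * m + 4) * kernel_coeff e q m x k"
    unfolding kernel_coeff_def ab' V_def U_def G_def H_def F_def by (simp add: mult_ac)
  finally show ?thesis .
qed

text \<open>Replacing \<open>Suc y\<close> by \<open>y\<close> shifts the base by one step, so the
  two symbols share all but one factor each, and the common part is the symbol of length
  \<open>k\<close>.\<close>

lemma qpoch_difference:
  "qpoch ((q\<^sup>2) powi (- int (Suc y))) (q\<^sup>2) (Suc k) - qpoch ((q\<^sup>2) powi (- int y)) (q\<^sup>2) (Suc k) =
    - (qpoch ((q\<^sup>2) powi (- int y)) (q\<^sup>2) k * inverse (q ^ (2 * y + 2)) * (1 - (q\<^sup>2) ^ Suc k))"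
proof -
  have shift: "(q\<^sup>2) powi (- int (Suc y)) * q\<^sup>2 = (q\<^sup>2) powi (- int y)"
    using power_int_add_1[of "q\<^sup>2" "- int (Suc y)"] nonzero by simp
  have "(q\<^sup>2) powi (- int (Suc y)) = inverse (q ^ (2 * y + 2))"
    using sq_powi[of "Suc y"] by (simp add: add.commute)
  moreover have "(q\<^sup>2) powi (- int y) * (q\<^sup>2) ^ k = inverse (q ^ (2 * y + 2)) * (q\<^sup>2) ^ Suc k"
    using nonzero by (simp add: power_int_minus power_mult power_add power2_eq_square field_simps)
  ultimately show ?thesis
    using nonzero
    unfolding qpoch_Suc_left[of "(q\<^sup>2) powi (- int (Suc y))"] qpoch_Suc[of "(q\<^sup>2) powi (- int y)"] shift
    by (simp add: algebra_simps)
qed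

text \<open>The counterpart of \<open>ev_step\<close>: the difference in \<open>y\<close> lowers the
  length of the symbol by one, and \<open>kernel_coeff_step\<close> lowers the other parameters to
  match.\<close>

lemma kernel_step:
  assumes "2 * y \<le> m"
  shows "krawtchouk_kernel e q (Suc (Suc m)) (Suc x) (Suc y) =
    krawtchouk_kernel e q (Suc (Suc m)) (Suc x) y - e * q ^ (2 * m + 2 - 2 * y) * krawtchouk_kernel e q m x y"
proof -
  let ?c = "kernel_coeff e q (Suc (Suc m)) (Suc x)" and ?p = "\<lambda>y. qpoch ((q\<^sup>2) powi (- int y)) (q\<^sup>2)"
  \<comment> \<open>The extra term \<open>k = Suc y\<close> is zero, so both kernels are sums over
    the same range.\<close>
  have "krawtchouk_kernel e q (Suc (Suc m)) (Suc x) y = (\<Sum>k\<le>Suc y. ?c k * ?p y k)"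
    using nonzero qpoch_inverse_power_eq_0[of "q\<^sup>2" y "Suc y"] by (simp add: krawtchouk_kernel_def)
  then have "krawtchouk_kernel e q (Suc (Suc m)) (Suc x) (Suc y) - krawtchouk_kernel e q (Suc (Suc m)) (Suc x) y =
      (\<Sum>k\<le>Suc y. ?c k * (?p (Suc y) k - ?p y k))"
    by (simp add: krawtchouk_kernel_def sum_subtractf right_diff_distrib)
  also have "\<dots> = (\<Sum>k\<le>y. ?c (Suc k) * (?p (Suc y) (Suc k) - ?p y (Suc k)))"
    by (subst sum.atMost_Suc_shift) (simp add: qpoch_def)
  also have "\<dots> = (\<Sum>k\<le>y. - (e * q ^ (2 * m + 2 - 2 * y)) * (kernel_coeff e q m x k * ?p y k))"
  proof (rule sum.cong[OF refl])
    fix k assume "k \<in> {..y}"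
    then have "2 * k \<le> m" using assms by simp
    have "q ^ (2 * m + 4) = q ^ (2 * m + 2 - 2 * y) * q ^ (2 * y + 2)"
      unfolding power_add[symmetric] using assms by (intro arg_cong[of _ _ "power q"]) simp
    then have qq: "q ^ (2 * m + 4) * inverse (q ^ (2 * y + 2)) = q ^ (2 * m + 2 - 2 * y)"
      using nonzero by (simp add: field_simps)
    have "?c (Suc k) * (?p (Suc y) (Suc k) - ?p y (Suc k)) =
        - (?p y k * inverse (q ^ (2 * y + 2)) * (?c (Suc k) * (1 - (q\<^sup>2) ^ Suc k)))"
      unfolding qpoch_difference by (simp only: mult_minus_right mult_ac)
    also have "\<dots> = - (e * (q ^ (2 * m + 4) * inverse (q ^ (2 * y + 2))) * (kernel_coeff e q m x k * ?p y k))"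
      unfolding kernel_coeff_step[OF \<open>2 * k \<le> m\<close>] by (simp only: mult_ac)
    finally show "?c (Suc k) * (?p (Suc y) (Suc k) - ?p y (Suc k)) =
        - (e * q ^ (2 * m + 2 - 2 * y)) * (kernel_coeff e q m x k * ?p y k)"
      unfolding qq by simp
  qed
  also have "\<dots> = - (e * q ^ (2 * m + 2 - 2 * y)) * krawtchouk_kernel e q m x y"
    by (simp only: krawtchouk_kernel_def sum_distrib_left)
  finally show ?thesis by (simp add: algebra_simps)
qed

lemma kernel_0_right: "krawtchouk_kernel e q m x 0 = (- e) ^ x * q ^ (x\<^sup>2) * falling q m x / qpoch (q\<^sup>2) (q\<^sup>2) x"
  by (simp add: krawtchouk_kernel_def kernel_coeff_def qpoch_def)

lemma kernel_0_left: "krawtchouk_kernel e q m 0 y = 1"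
proof -
  have "krawtchouk_kernel e q m 0 y = (\<Sum>k\<le>y. if k = 0 then 1 else 0)"
    unfolding krawtchouk_kernel_def
    using qpoch_inverse_power_eq_0[of "q\<^sup>2" 0] nonzero
    by (intro sum.cong refl) (auto simp: kernel_coeff_def qpoch_def)
  then show ?thesis by simp
qed

text \<open>The counterpart of \<open>signed_count_step\<close>: at \<open>y = 0\<close> the
  polynomial is 1 and only the prefactor changes.\<close>

lemma kernel_0_right_step:
  "(q ^ (2 * x + 2) - 1) * krawtchouk_kernel e q (Suc (Suc m)) (Suc x) 0 =
    e * q ^ (2 * x + 1) * (q ^ (m + 2) - 1) * (q ^ (m + 1) - 1) * krawtchouk_kernel e q m x 0"
proof -
  have "(Suc x)\<^sup>2 = x\<^sup>2 + (2 * x + 1)" by (simp add: power2_eq_square)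
  then have sq: "q ^ ((Suc x)\<^sup>2) = q ^ (x\<^sup>2) * q ^ (2 * x + 1)" by (simp only: power_add)
  have G: "qpoch (q\<^sup>2) (q\<^sup>2) (Suc x) = qpoch (q\<^sup>2) (q\<^sup>2) x * (1 - q ^ (2 * x + 2))"
    using sq_power[of "Suc x"] by (simp add: qpoch_Suc)
  define X where "X = q ^ (2 * x + 2)"
  define Y where "Y = q ^ (2 * x + 1)"
  define a where "a = q ^ (m + 2)"
  define b where "b = q ^ (m + 1)"
  have X: "1 - X \<noteq> 0" using power_neq_1[of "2 * x + 2"] by (auto simp: X_def)
  show ?thesis
    unfolding kernel_0_right falling_Suc_Suc sq G X_def[symmetric] Y_def[symmetric] a_def[symmetric] b_def[symmetric]
    using X qpoch_neq_0[of x] by (simp add: divide_simps) (simp add: algebra_simps)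
qed

text \<open>The exponents \<open>2 * (m div 2)\<close> and
  \<open>2 * (m div 2) + (-1) ^ Suc m\<close> are \<open>m\<close> and \<open>m - 1\<close> in an
  order depending on the parity of \<open>m\<close>; both symbols descend by two, so together they
  run through \<open>m, m - 1, ...\<close> once.\<close>

lemma falling_eq_qpoch:
  assumes "2 * x \<le> m"
  shows "falling q m x = qpoch (q powi (2 * int (m div 2) + (-1) ^ Suc m)) (q powi (-2)) x *
    qpoch ((q\<^sup>2) ^ (m div 2)) (inverse (q\<^sup>2)) x"
  using assms
proof (induction x)
  case (Suc x)
  have pw: "q powi i * (q powi (-2)) ^ x = q powi (i - 2 * int x)" for i
    using nonzero by (simp add: power_int_diff power_int_minus power_int_mult power_inverse power_mult_distrib power2_eq_square field_simps)
  have ev: "(q\<^sup>2) ^ (m div 2) * inverse (q\<^sup>2) ^ x = q ^ (2 * (m div 2) - 2 * x)"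
    using nonzero Suc.prems
    by (simp add: power_diff power_mult power_inverse power_mult_distrib power2_eq_square field_simps)
  have "(1 - q powi (2 * int (m div 2) + (-1) ^ Suc m) * (q powi (-2)) ^ x) *
      (1 - (q\<^sup>2) ^ (m div 2) * inverse (q\<^sup>2) ^ x) = (1 - q ^ (m - 2 * x)) * (1 - q ^ (m - 2 * x - 1))"
  proof (cases "even m")
    case True
    then have e: "2 * int (m div 2) + (-1) ^ Suc m - 2 * int x = int (m - 2 * x - 1)"
      using Suc.prems by auto
    show ?thesis unfolding pw ev e using True by (simp add: mult.commute)
  next
    case False
    then have e: "2 * int (m div 2) + (-1) ^ Suc m - 2 * int x = int (m - 2 * x)" "2 * (m div 2) = m - 1"
      using Suc.prems by (auto elim!: oddE)
    show ?thesis unfolding pw ev e by (simp add: diff_commute)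
  qed
  with Suc show ?case by (simp add: falling_Suc qpoch_Suc mult_ac)
qed (simp add: qpoch_def)

text \<open>The same interlacing for the denominator symbols, whose bases have negative exponents;
  this identifies the parameters \<open>a\<close> and \<open>N\<close> of the polynomial.\<close>

lemma falling_inverse_eq_qpoch:
  assumes "2 * k \<le> m"
  shows "falling (inverse q) m k = qpoch ((q\<^sup>2) powi (- int (m div 2))) (q\<^sup>2) k *
    qpoch (q powi (- 2 * int (m div 2) - (-1) ^ Suc m)) (q\<^sup>2) k"
  using assms
proof (induction k)
  case (Suc k)
  have pw: "q powi i * (q\<^sup>2) ^ k = q powi (i + 2 * int k)" for i
    using nonzero by (simp add: power_int_add power_int_mult)
  have ev: "(q\<^sup>2) powi (- int (m div 2)) * (q\<^sup>2) ^ k = inverse q ^ (2 * (m div 2) - 2 * k)"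
    using nonzero Suc.prems
    by (simp add: power_diff power_mult power_inverse power_int_minus power_mult_distrib power2_eq_square field_simps)
  have "(1 - (q\<^sup>2) powi (- int (m div 2)) * (q\<^sup>2) ^ k) *
      (1 - q powi (- 2 * int (m div 2) - (-1) ^ Suc m) * (q\<^sup>2) ^ k) =
      (1 - inverse q ^ (m - 2 * k)) * (1 - inverse q ^ (m - 2 * k - 1))"
  proof (cases "even m")
    case True
    then have e: "- 2 * int (m div 2) - (-1) ^ Suc m + 2 * int k = - int (m - 2 * k - 1)"
      using Suc.prems by auto
    show ?thesis unfolding pw ev e using True by (simp add: power_int_minus power_inverse)
  next
    case False
    then have e: "- 2 * int (m div 2) - (-1) ^ Suc m + 2 * int k = - int (m - 2 * k)" "2 * (m div 2) = m - 1"
      using Suc.prems by (auto elim!: oddE)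
    show ?thesis unfolding pw ev e by (simp add: power_int_minus power_inverse diff_commute)
  qed
  with Suc show ?case by (simp add: falling_Suc qpoch_Suc mult_ac)
qed (simp add: qpoch_def)

lemma kernel_eq_Krawtchouk:
  assumes "2 * x \<le> m" "2 * y \<le> m"
  shows "krawtchouk_kernel e q m x y = (- e) ^ x * q ^ (x\<^sup>2) *
    qpoch (q powi (2 * int (m div 2) + (-1) ^ Suc m)) (q powi (-2)) x * qbinom (m div 2) x (q\<^sup>2) *
    affine_q_Krawtchouk y x (q powi (- 2 * int (m div 2) - (-1) ^ Suc m)) (m div 2) (q\<^sup>2)"
proof -
  have "krawtchouk_kernel e q m x y = (- e) ^ x * q ^ (x\<^sup>2) * (falling q m x / qpoch (q\<^sup>2) (q\<^sup>2) x) *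
      (\<Sum>k\<le>y. qpoch ((q\<^sup>2) powi (- int y)) (q\<^sup>2) k * qpoch ((q\<^sup>2) powi (- int x)) (q\<^sup>2) k /
        (falling (inverse q) m k * qpoch (q\<^sup>2) (q\<^sup>2) k) * (q\<^sup>2) ^ k)"
    unfolding krawtchouk_kernel_def kernel_coeff_def sum_distrib_left by (intro sum.cong refl) (simp add: mult_ac)
  also have "(\<Sum>k\<le>y. qpoch ((q\<^sup>2) powi (- int y)) (q\<^sup>2) k * qpoch ((q\<^sup>2) powi (- int x)) (q\<^sup>2) k /
        (falling (inverse q) m k * qpoch (q\<^sup>2) (q\<^sup>2) k) * (q\<^sup>2) ^ k) =
      affine_q_Krawtchouk y x (q powi (- 2 * int (m div 2) - (-1) ^ Suc m)) (m div 2) (q\<^sup>2)"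
    unfolding affine_q_Krawtchouk_def atMost_atLeast0
    using assms(2) by (intro sum.cong refl) (simp add: falling_inverse_eq_qpoch)
  finally show ?thesis
    unfolding falling_eq_qpoch[OF assms(1)] qbinom_def by (simp add: mult_ac)
qed

end

section \<open>The coefficients\<close>

context odd_field_transform
begin

lemma not_root_of_unity_q: "not_root_of_unity q"
proof
  show "q ^ k \<noteq> 1" if "k > 0" for k
  proof
    assume "q ^ k = 1"
    then have "CARD('a) ^ k = 1" by (simp add: q_eq flip: of_nat_power)
    with that have "CARD('a) = 1" by simp
    then show False using card_mono[of UNIV "{0, 1 :: 'a}"] by simp
  qed
qed simp

text \<open>Both sides obey the same recurrences: in \<open>x\<close> along \<open>y = 0\<close>,
  and in \<open>y\<close> with \<open>m\<close> and \<open>x\<close> varying, since the step in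
  \<open>y\<close> also lowers the size and \<open>x\<close>.\<close>

lemma ev_even_eq_kernel:
  assumes "2 * x \<le> m" "2 * y \<le> m"
  shows "ev m (2 * x) (2 * y) = krawtchouk_kernel eps q m x y"
proof -
  interpret not_root_of_unity q by (rule not_root_of_unity_q)
  have ev_0: "ev m 0 s = 1" for m s by (simp add: ev_def ft_rank_0)
  have base: "ev m (2 * x) 0 = krawtchouk_kernel eps q m x 0" if "2 * x \<le> m" for x m
    using that
  proof (induction x arbitrary: m)
    case (Suc x)
    then obtain k where "m = 2 + k" using le_Suc_ex[of 2 m] by auto
    then have m: "m = Suc (Suc k)" by simp
    then have k: "2 * x \<le> k" using Suc.prems by simp
    have "(q ^ (2 * x + 2) - 1) * ev m (2 * Suc x) 0 = (q ^ (2 * x + 2) - 1) * krawtchouk_kernel eps q m (Suc x) 0"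
      using signed_count_step[OF k] kernel_0_right_step[of x eps k] Suc.IH[OF k]
      by (simp only: m)
    \<comment> \<open>The boundary recurrence determines the next value only after division by this
      factor.\<close>
    moreover have "q ^ (2 * x + 2) - 1 \<noteq> 0" using power_neq_1[of "2 * x + 2"] by simp
    ultimately show ?case by (metis mult_left_cancel)
  qed (simp add: ev_0 kernel_0_left)
  show ?thesis
    using assms
  proof (induction y arbitrary: m x)
    case 0
    then show ?case using base by simp
  next
    case (Suc y)
    then obtain k where "m = 2 + k" using le_Suc_ex[of 2 m] by auto
    then have m: "m = Suc (Suc k)" by simp
    show ?case
    proof (cases x)
      case 0
      then show ?thesis by (simp add: ev_0 kernel_0_left)
    next
      case (Suc z)
      with Suc.IH[of x m] Suc.IH[of z k] Suc.prems m show ?thesis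
        by (simp add: ev_step[of y k z, simplified] kernel_step[of y k eps z])
    qed
  qed
qed

text \<open>One peel from odd to even rank: the old value vanishes and the Gauss term, with
  \<open>gauss ^ (2 * y)\<close> evaluated, gives the prefactor.\<close>

lemma ev_odd_eq_kernel:
  assumes "2 * x \<le> m" "2 * y \<le> m"
  shows "ev (Suc m) (Suc (2 * x)) (Suc (2 * y)) = eps ^ y * q ^ (m - y) * gauss * krawtchouk_kernel eps q m x y"
proof -
  have "ev (Suc m) (Suc (2 * x)) (Suc (2 * y)) = gauss * (q ^ (m - 2 * y) * gauss ^ (2 * y)) * ev m (2 * x) (2 * y)"
    using ev_peel[of "2 * y" m "2 * x"] ev_odd_even[of "Suc (2 * x)" "2 * y" "Suc m"] assms
    by (simp add: peel_coeff_odd)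
  also have "q ^ (m - 2 * y) * gauss ^ (2 * y) = eps ^ y * q ^ (m - 2 * y + y)"
    by (simp add: gauss_power_even power_add)
  also have "m - 2 * y + y = m - y" using assms by simp
  finally show ?thesis unfolding ev_even_eq_kernel[OF assms] by (simp only: mult_ac)
qed

lemma fourier_eq_ft:
  assumes \<psi>: "\<And>a. \<psi> a = cnj (\<theta> a)" and b: "b \<in> Sym n"
  shows "fourier n (sgn_chi \<delta> n r) (sym_char \<theta> b) = ft 1 n r b"
proof -
  have "transpose_mat b = b" using b by (simp add: Sym_def)
  then show ?thesis
    by (simp add: fourier_def ft_def sgn_chi_def sym_char_def \<psi> mult_ac)
qed

text \<open>At rank 0 there is a single orbit and the signed basis functions start at index 1, so
  only \<open>c 0\<close> is visible there.\<close>

lemma expansion_eq: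
  fixes b :: "'a mat"
  assumes b: "b \<in> Sym n"
  shows "(\<Sum>s=0..n. c s * chi n s b) + (\<Sum>s=1..n. d s * sgn_chi \<delta> n s b) =
    c (vec_space.rank n b) + (if vec_space.rank n b = 0 then 0 else d (vec_space.rank n b) * sg n b)"
proof -
  let ?k = "vec_space.rank n b"
  have k: "?k \<le> n" by (rule rank_Sym_le[OF b])
  have "(\<Sum>s=0..n. c s * chi n s b) = (\<Sum>s=0..n. if s = ?k then c s else 0)"
    by (intro sum.cong) (auto simp: chi_def)
  moreover have "(\<Sum>s=1..n. d s * sgn_chi \<delta> n s b) = (\<Sum>s=1..n. if s = ?k then d s * sg n b else 0)"
    by (intro sum.cong) (auto simp: chi_def sgn_chi_def)
  ultimately show ?thesis using k by (simp add: sum.delta)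
qed

text \<open>At rank \<open>s\<close> the two orbits have the values \<open>c s + d s\<close> and
  \<open>c s - d s\<close>, which determines \<open>d s\<close> as half their difference; for odd
  \<open>s\<close> and \<open>r\<close> the two values are opposite.\<close>

lemma Psi4_eq_ev:
  assumes \<psi>: "\<And>a. \<psi> a = cnj (\<theta> a)" and s: "odd s" "s \<le> n" and r: "odd r"
  shows "Psi4 \<theta> \<delta> n s r = ev n r s"
  unfolding Psi4_def
proof (rule the_equality)
  let ?f = "\<lambda>b. ft 1 n r b"
  let ?d1 = "\<lambda>k. ?f (diag_one n k)" and ?d2 = "\<lambda>k. ?f (diag_delta \<delta> n k)"
  have diag: "vec_space.rank n (diag_one n k :: 'a mat) = k" "sg n (diag_one n k) = 1"
    "1 \<le> k \<Longrightarrow> vec_space.rank n (diag_delta \<delta> n k) = k" "1 \<le> k \<Longrightarrow> sg n (diag_delta \<delta> n k) = -1"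
    if "k \<le> n" for k
    using that delta_neq_0 by (simp_all add: rank_diag_one sgn_sym_diag_one rank_diag_delta
      sgn_sym_diag_delta_orbit(1)[OF _ _ in_orbit_refl] Sym_carrier)
  \<comment> \<open>For odd \<open>s\<close>, scaling by \<open>\<delta>\<close> exchanges the two
    orbits of rank \<open>s\<close>; for odd \<open>r\<close> it negates the transform.\<close>
  have neg: "?d2 s = - ?d1 s"
  proof -
    have "1 \<le> s" using s by (cases s) auto
    then have "?d2 s = ?f (\<delta> \<cdot>\<^sub>m diag_one n s)"
      using s diag[of s] delta_neq_0
      by (intro ft_cong) (auto simp: rank_smult sgn_sym_smult quadratic_char_nonsquare intro: Sym_closed)
    also have "\<dots> = - ?d1 s"
      using ft_smult[OF delta_neq_0 diag_one_Sym[of n s], of 1 r] r by (simp add: quadratic_char_nonsquare)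
    finally show ?thesis .
  qed
  \<comment> \<open>Half sum and half difference of the values on the two orbits, except at rank 0,
    where \<open>c 0\<close> must be the value at the only orbit.\<close>
  define c where "c k = (if k = 0 then ?d1 0 else (?d1 k + ?d2 k) / 2)" for k
  define d where "d k = (?d1 k - ?d2 k) / 2" for k
  have "has_expansion \<theta> \<delta> n (fourier n (sgn_chi \<delta> n r)) c d"
    unfolding has_expansion_def
  proof
    fix b :: "'a mat" assume b: "b \<in> Sym n"
    have "?f b = c (vec_space.rank n b) + (if vec_space.rank n b = 0 then 0 else d (vec_space.rank n b) * sg n b)"
      using b
    proof (cases rule: Sym_cases)
      case (1 k)
      then show ?thesis
        using ft_in_orbit[OF 1(2)] sgn_sym_diag_one_orbit[OF 1]
        by (simp add: Sym_carrier c_def d_def field_simps)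
    next
      case (2 k)
      then show ?thesis
        using ft_in_orbit[OF 2(3)] sgn_sym_diag_delta_orbit[OF 2]
        by (simp add: Sym_carrier c_def d_def field_simps)
    qed
    then show "fourier n (sgn_chi \<delta> n r) (sym_char \<theta> b) =
        (\<Sum>s=0..n. c s * chi n s b) + (\<Sum>s=1..n. d s * sgn_chi \<delta> n s b)"
      unfolding expansion_eq[OF b] using fourier_eq_ft[OF \<psi> b] by simp
  qed
  moreover have "ev n r s = d s" using neg by (simp add: d_def ev_def)
  ultimately show "\<exists>c d. has_expansion \<theta> \<delta> n (fourier n (sgn_chi \<delta> n r)) c d \<and> ev n r s = d s" by blast
  fix z assume "\<exists>c d. has_expansion \<theta> \<delta> n (fourier n (sgn_chi \<delta> n r)) c d \<and> z = d s"
  then obtain c d where exp: "has_expansion \<theta> \<delta> n (fourier n (sgn_chi \<delta> n r)) c d" and z: "z = d s"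
    by blast
  have expansion: "?f b = c (vec_space.rank n b) + (if vec_space.rank n b = 0 then 0 else d (vec_space.rank n b) * sg n b)"
    if b: "b \<in> Sym n" for b
  proof -
    from exp b have "fourier n (sgn_chi \<delta> n r) (sym_char \<theta> b) =
        (\<Sum>s=0..n. c s * chi n s b) + (\<Sum>s=1..n. d s * sgn_chi \<delta> n s b)"
      unfolding has_expansion_def by blast
    then show ?thesis unfolding expansion_eq[OF b] fourier_eq_ft[OF \<psi> b] .
  qed
  have "1 \<le> s" using s by (cases s) auto
  then have "?d1 s = c s + d s" "?d2 s = c s - d s"
    using expansion[of "diag_one n s"] expansion[of "diag_delta \<delta> n s"] diag[OF s(2)] by simp_all
  with neg have "2 * d s = 2 * ?d1 s" by simp
  then show "z = ev n r s" by (simp add: z ev_def)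
qed

end

theorem proposition6p4p6:
  fixes \<theta> :: "'a :: finite_field \<Rightarrow> complex"
    and \<delta> :: 'a
    and q \<epsilon> \<gamma> :: complex
    and n s r N x y :: nat
  assumes odd_order: "odd CARD('a)"
    and q: "q = of_nat CARD('a)"
    and \<theta>: "additive_character \<theta>" "\<exists>a. \<theta> a \<noteq> 1"
    and \<delta>: "\<not> is_square \<delta>"
    and \<epsilon>: "\<epsilon> = (if CARD('a) mod 4 = 1 then 1 else -1)"
    and \<gamma>: "\<gamma> = (\<Sum>a\<in>UNIV - {0}. (if is_square a then 1 else -1) * cnj (\<theta> a))"
    and n: "1 \<le> n"
    and s: "odd s" "1 \<le> s" "s \<le> n"
    and r: "odd r" "1 \<le> r" "r \<le> n"
    and N: "N = (n - 1) div 2"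
    and y: "y = (s - 1) div 2"
    and x: "x = (r - 1) div 2"
  shows "Psi4 \<theta> \<delta> n s r =
    (-1) ^ x * \<epsilon> ^ (x + y) * q powi (int n + int x ^ 2 - int y - 1) * \<gamma>
    * qpoch (q powi (2 * int N + (-1) ^ n)) (q powi (-2)) x
    * qbinom N x (q ^ 2)
    * affine_q_Krawtchouk y x (q powi (- 2 * int N - (-1) ^ n)) N (q ^ 2)"
proof -
  interpret odd_field_transform "\<lambda>a. cnj (\<theta> a)" q \<delta> \<epsilon>
  proof
    show "additive_character (\<lambda>a. cnj (\<theta> a))"
      using \<theta>(1) by (simp add: additive_character_def)
    show "\<exists>a. cnj (\<theta> a) \<noteq> 1" using \<theta>(2) by (metis complex_cnj_cnj complex_cnj_one)
  qed (fact odd_order q \<delta> \<epsilon>)+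
  interpret not_root_of_unity q by (rule not_root_of_unity_q)
  \<comment> \<open>The peel from odd to even rank reduces the size to \<open>m\<close>, so that
    \<open>N\<close> is \<open>m div 2\<close> and \<open>(-1) ^ n\<close> is
    \<open>(-1) ^ Suc m\<close>.\<close>
  obtain m where m: "n = Suc m" using n by (cases n) auto
  have sy: "s = Suc (2 * y)" and rx: "r = Suc (2 * x)" using s r x y by (auto elim!: oddE)
  then have le: "2 * x \<le> m" "2 * y \<le> m" using s r m by auto
  have "gauss = (\<Sum>a\<in>UNIV - {0}. quadratic_char a * cnj (\<theta> a))"
    by (simp add: gauss_def sum.remove[of UNIV 0])
  also have "\<dots> = \<gamma>" unfolding \<gamma> by (intro sum.cong) (auto simp: quadratic_char_def)
  finally have gauss: "gauss = \<gamma>" .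
  have "Psi4 \<theta> \<delta> n s r = ev n r s"
    using s r by (intro Psi4_eq_ev) auto
  also have "\<dots> = \<epsilon> ^ y * q ^ (m - y) * \<gamma> * krawtchouk_kernel \<epsilon> q m x y"
    unfolding m sy rx ev_odd_eq_kernel[OF le] gauss ..
  finally have "Psi4 \<theta> \<delta> n s r = \<epsilon> ^ y * q ^ (m - y) * \<gamma> * krawtchouk_kernel \<epsilon> q m x y" .
  moreover have "q powi (int n + int x ^ 2 - int y - 1) = q ^ (m - y) * q ^ (x\<^sup>2)"
  proof -
    have "int n + int x ^ 2 - int y - 1 = int (m - y + x\<^sup>2)" using le m by simp
    then show ?thesis by (simp only: power_int_of_nat power_add)
  qed
  moreover have "N = m div 2" using N m by simp
  moreover have "(- \<epsilon>) ^ x = (-1) ^ x * \<epsilon> ^ x" by (rule power_minus)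
  ultimately show ?thesis
    by (simp only: kernel_eq_Krawtchouk[OF le] m power_add mult_ac)
qed

end
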